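(* Let $\lambda,\mu,\beta>0$ with $\beta<\mu$ and $\lambda\neq\beta$. The condition $\lambda<\mu$ is necessary and sufficient for stability of the production inventory Markov chain $\{\mathcal X(t)\}_{t\ge 0}$ with parameters $\lambda,\mu,\beta$, and under this condition the components of the invariant measure $P=(P_0,P_1,P_2,\dots)$, $P_n=(P_{n,0},P_{n,1},P_{n,2},\dots)$, of $\{\mathcal X(t)\}_{t\ge0}$ are given by $$P_0=(1-\rho)\,\pi,\qquad P_n=(1-\rho)\,\rho^{n}\,\pi\quad (n\ge 1),$$ where $\rho=\lambda/\mu$ and $\pi=(\pi_0,\pi_1,\pi_2,\dots)$ is the inventory level probability vector $$\pi_i=\left(1-\frac{\beta}{\lambda}\right)\left(\frac{\beta}{\lambda}\right)^i,\qquad i=0,1,2,\dots .$$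
   Context: $\mathbb N_0=\{0,1,2,\dots\}$. The production inventory model is the continuous-time Markov chain $\mathcal X(t)=(\mathcal N(t),\mathcal I(t))$ on $\mathbb N_0\times\mathbb N_0$, where $\mathcal N(t)$ is the number of customers and $\mathcal I(t)$ the inventory level at time $t$, with the following transition rates: $(n,i)\to(n+1,i)$ at rate $\lambda$ if $n\ge 0$, $i\ge 1$ (no customer joins when the inventory is empty); $(n,i)\to(n-1,i-1)$ at rate $\mu$ if $n\ge1$, $i\ge 1$; $(n,i)\to(n,i+1)$ at rate $\beta$ for all $n,i\ge 0$; all other transitions between distinct states have rate $0$. "Stable" means positive recurrent. With $\mathcal Q$ the corresponding generator matrix (rows summing to zero), the invariant measure is the vector $P$ satisfying $P\mathcal Q=0$ and $\sum_{n,i}P_{n,i}=1$, where $P_{n,i}$ is the component at state $(n,i)$. The vector $\pi$ is the invariant measure of the inventory-level chain with negligible service time, i.e. the chain on $\mathbb N_0$ with rates $i\to i+1$ equal to $\beta$ for $i\ge0$ and $i\to i-1$ equal to $\lambda$ for $i\ge1$.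
   Formalization: The formal theorem assumes that π is an invariant probability vector of the inventory-level chain, which forces β<λ; for λ<β<μ the claim is false as worded, since λ<μ holds but the inventory grows without bound and the displayed π is not a probability vector. *)

theory Defs
  imports "HOL-Probability.Probability"
begin

text \<open>The diagonal entries make the rows sum to zero; \<open>r x x\<close> is never read.\<close>

definition generator :: "('a \<Rightarrow> 'a \<Rightarrow> real) \<Rightarrow> 'a \<Rightarrow> 'a \<Rightarrow> real" where
  "generator r x y = (if x = y then - (\<Sum>\<^sub>\<infinity>z\<in>-{x}. r x z) else r x y)"

definition production_rate :: "real \<Rightarrow> real \<Rightarrow> real \<Rightarrow> nat \<times> nat \<Rightarrow> nat \<times> nat \<Rightarrow> real" where
  "production_rate lam \<mu> \<beta> = (\<lambda>(n, i) (m, j).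
     if i \<ge> 1 \<and> m = n + 1 \<and> j = i then lam
     else if n \<ge> 1 \<and> i \<ge> 1 \<and> m = n - 1 \<and> j = i - 1 then \<mu>
     else if m = n \<and> j = i + 1 then \<beta>
     else 0)"

definition inventory_rate :: "real \<Rightarrow> real \<Rightarrow> nat \<Rightarrow> nat \<Rightarrow> real" where
  "inventory_rate lam \<beta> i j =
     (if j = i + 1 then \<beta> else if i \<ge> 1 \<and> j = i - 1 then lam else 0)"

text \<open>\<open>p Q = 0\<close> with total mass one. Nonnegativity of \<open>p\<close> is not required.\<close>

definition invariant_measure :: "('a \<Rightarrow> 'a \<Rightarrow> real) \<Rightarrow> ('a \<Rightarrow> real) \<Rightarrow> bool" where
  "invariant_measure Q p \<longleftrightarrow>
     (\<forall>y. ((\<lambda>x. p x * Q x y) has_sum 0) UNIV) \<and> (p has_sum 1) UNIV"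

definition jump_prob :: "('a \<Rightarrow> 'a \<Rightarrow> real) \<Rightarrow> 'a \<Rightarrow> 'a \<Rightarrow> real" where
  "jump_prob Q x y = (if x = y then 0 else Q x y / (- Q x x))"

text \<open>
  \<open>X\<close> is, under the law \<open>M\<close>, a continuous-time Markov chain on a countable state space with
  generator \<open>Q\<close>, started in \<open>x\<close>. This is the description by jump chain and holding times:
  the successive states \<open>Y\<close> form a discrete-time Markov chain with transition matrix
  \<open>jump_prob Q\<close>, and, given \<open>Y\<close>, the successive holding times \<open>S\<close> are independent, \<open>S k\<close> being
  exponential with parameter \<open>- Q (Y k) (Y k)\<close>. The measure of the cylinder sets below
  determines the joint law of \<open>Y\<close> and \<open>S\<close>. The last clause says that the jump times do not
  accumulate (no explosion). As holding times are real-valued, the definition is meant for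
  generators without absorbing states.
\<close>

definition markov_chain ::
    "('a \<Rightarrow> 'a \<Rightarrow> real) \<Rightarrow> 'a \<Rightarrow> 'w measure \<Rightarrow> (real \<Rightarrow> 'w \<Rightarrow> 'a) \<Rightarrow> bool" where
  "markov_chain Q x M X \<longleftrightarrow>
     prob_space M \<and>
     (\<forall>t\<ge>0. X t \<in> measurable M (count_space UNIV)) \<and>
     (\<exists>(Y :: nat \<Rightarrow> 'w \<Rightarrow> 'a) (S :: nat \<Rightarrow> 'w \<Rightarrow> real).
        (\<forall>k. Y k \<in> measurable M (count_space UNIV)) \<and>
        (\<forall>k. S k \<in> borel_measurable M) \<and>
        (\<forall>n y t. (\<forall>k\<le>n. 0 \<le> t k) \<longrightarrow>
           measure M {\<omega> \<in> space M. \<forall>k\<le>n. Y k \<omega> = y k \<and> t k < S k \<omega>} =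
             (if y 0 = x then 1 else 0) * (\<Prod>k<n. jump_prob Q (y k) (y (Suc k)))
             * (\<Prod>k\<le>n. exp (Q (y k) (y k) * t k))) \<and>
        (AE \<omega> in M. \<forall>t\<ge>0. \<exists>n. (\<Sum>k<n. S k \<omega>) \<le> t \<and> t < (\<Sum>k<Suc n. S k \<omega>) \<and>
           X t \<omega> = Y n \<omega>))"

text \<open>First time in \<open>x\<close> after having left \<open>x\<close>; it is \<open>\<infinity>\<close> (infimum of the empty set) if the
  path never returns.\<close>

definition return_time :: "(real \<Rightarrow> 'w \<Rightarrow> 'a) \<Rightarrow> 'a \<Rightarrow> 'w \<Rightarrow> ennreal" where
  "return_time X x \<omega> =
     (INF t\<in>{t. 0 \<le> t \<and> X t \<omega> = x \<and> (\<exists>s\<in>{0..t}. X s \<omega> \<noteq> x)}. ennreal t)"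

text \<open>\<open>M x\<close> is the law under which the chain \<open>X\<close> starts in \<open>x\<close>.\<close>

definition positive_recurrent :: "('a \<Rightarrow> 'w measure) \<Rightarrow> (real \<Rightarrow> 'w \<Rightarrow> 'a) \<Rightarrow> bool" where
  "positive_recurrent M X \<longleftrightarrow> (\<forall>x. (\<integral>\<^sup>+\<omega>. return_time X x \<omega> \<partial>M x) < \<infinity>)"

end

theory Submission
  imports Defs
begin

text \<open>Write \<open>q y\<close> for the exit rate of \<open>y\<close>. The expected time to return to \<open>x\<close> is a sum of holding
  times: the chain stays in \<open>y\<close> for a mean time \<open>1 / q y\<close> at each visit, so the expected return
  time is \<open>\<Sum>y. green x y / q y\<close>, where \<open>green x y\<close> is the expected number of visits to \<open>y\<close> by the jump
  chain before it comes back to \<open>x\<close> (\<open>markov_chain_expected_return_time\<close>). Stability thus becomes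
  a question about the generator alone.

  If \<open>lam < \<mu>\<close>, the product form \<open>m (n, i) = \<rho> ^ n * (\<beta> / lam) ^ i\<close> is a summable positive
  solution of the balance equations. Since \<open>m y * q y\<close> is invariant for the jump chain, it
  dominates \<open>green x y\<close> up to a constant, and all expected return times are finite
  (\<open>finite_expected_return_time\<close>). Here \<open>\<beta> < lam\<close> because the inventory chain has a normalizable
  invariant vector (\<open>inventory_balance\<close>).

  Conversely, if the expected return time to \<open>x\<close> is finite, then \<open>g y = green x y / q y\<close> is summable
  and satisfies every balance equation except perhaps the one at \<open>x\<close>. Take \<open>x = (0, 1)\<close> and let
  \<open>a n\<close> be the mass under \<open>g\<close> of the states with \<open>n\<close> customers and nonempty inventory. The net flow
  \<open>lam * a n - \<mu> * a (n + 1)\<close> between two neighbouring levels does not depend on \<open>n\<close>; it vanishes, as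
  \<open>a\<close> tends to zero. So \<open>a n = (lam / \<mu>) ^ n * a 0\<close> with \<open>a 0 > 0\<close>, which excludes \<open>\<mu> \<le> lam\<close>
  (\<open>infinite_expected_return_time\<close>).

  Finally, the invariant measure is unique even among signed summable solutions. A multiple of \<open>m\<close>
  is subtracted from a given solution so that the difference \<open>h\<close> vanishes at one state. Then \<open>\<bar>h\<bar>\<close> is
  again invariant, and a nonnegative invariant vector of an irreducible chain that vanishes somewhere
  vanishes everywhere (\<open>signed_invariant_eq_0\<close>).\<close>

section \<open>Conservative generators and visits before return\<close>

lemma has_sum_iff_nn_integral:
  fixes f :: "'a \<Rightarrow> real"
  assumes "\<And>x. 0 \<le> f x" and "0 \<le> c"
  shows "(f has_sum c) UNIV \<longleftrightarrow> (\<integral>\<^sup>+x. ennreal (f x) \<partial>count_space UNIV) = ennreal c"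
proof
  assume hs: "(f has_sum c) UNIV"
  then have abs: "Infinite_Set_Sum.abs_summable_on f UNIV"
    using summable_on_iff_abs_summable_on_real abs_summable_equivalent
    by (metis has_sum_imp_summable)
  have "(\<integral>\<^sup>+x. ennreal (f x) \<partial>count_space UNIV) = ennreal (infsetsum f UNIV)"
    by (rule nn_integral_conv_infsetsum[OF abs]) (rule assms)
  also have "infsetsum f UNIV = c"
    using infsetsum_infsum[OF abs] infsumI[OF hs] by simp
  finally show "(\<integral>\<^sup>+x. ennreal (f x) \<partial>count_space UNIV) = ennreal c" .
next
  assume eq: "(\<integral>\<^sup>+x. ennreal (f x) \<partial>count_space UNIV) = ennreal c"
  then have "integrable (count_space UNIV) f"
    using assms by (intro integrableI_nonneg) auto
  then have abs: "Infinite_Set_Sum.abs_summable_on f UNIV"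
    by (simp add: Infinite_Set_Sum.abs_summable_on_def)
  then have summ: "f summable_on UNIV"
    using summable_on_iff_abs_summable_on_real abs_summable_equivalent by metis
  have "ennreal (infsetsum f UNIV) = ennreal c"
    using eq nn_integral_conv_infsetsum[OF abs] assms by simp
  moreover have "infsetsum f UNIV = infsum f UNIV" by (rule infsetsum_infsum[OF abs])
  ultimately have "infsum f UNIV = c"
    using assms infsum_nonneg[of UNIV f] by simp
  then show "(f has_sum c) UNIV" using summ by auto
qed

text \<open>A conservative generator without absorbing states. Together with the sign of the off-diagonal
  entries, the last condition makes \<open>jump_prob Q\<close> a stochastic matrix. The exit rate of \<open>x\<close> is
  \<open>- Q x x\<close>.\<close>

locale conservative =
  fixes Q :: "'a::countable \<Rightarrow> 'a \<Rightarrow> real"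
  assumes off_diagonal: "x \<noteq> y \<Longrightarrow> 0 \<le> Q x y"
    and diagonal: "Q x x < 0"
    and row_sum: "((\<lambda>y. Q x y) has_sum 0) UNIV"
begin

lemma jump_prob_nonneg: "0 \<le> jump_prob Q x y"
  using off_diagonal[of x y] diagonal[of x] by (auto simp: jump_prob_def divide_simps)

lemma nn_integral_off_diagonal:
  "(\<integral>\<^sup>+y. ennreal (if x = y then 0 else Q x y) \<partial>count_space UNIV) = ennreal (- Q x x)"
proof -
  let ?f = "\<lambda>y. if x = y then 0 else Q x y"
  have "((\<lambda>y. if y = x then - Q x x else 0) has_sum - Q x x) UNIV"
    by (rule has_sum_finite_neutralI[of "{x}"]) auto
  from has_sum_add[OF row_sum[of x] this]
  have "((\<lambda>y. Q x y + (if y = x then - Q x x else 0)) has_sum - Q x x) UNIV" by simp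
  also have "(\<lambda>y. Q x y + (if y = x then - Q x x else 0)) = ?f" by auto
  finally have hs: "(?f has_sum - Q x x) UNIV" .
  then show ?thesis
    using off_diagonal diagonal[of x] by (subst (asm) has_sum_iff_nn_integral) (auto simp: less_imp_le)
qed

lemma nn_integral_jump_prob: "(\<integral>\<^sup>+y. ennreal (jump_prob Q x y) \<partial>count_space UNIV) = 1"
proof -
  have "(\<integral>\<^sup>+y. ennreal (jump_prob Q x y) \<partial>count_space UNIV) =
      (\<integral>\<^sup>+y. ennreal (if x = y then 0 else Q x y) * ennreal (1 / - Q x x) \<partial>count_space UNIV)"
    using off_diagonal diagonal[of x]
    by (intro nn_integral_cong) (auto simp: jump_prob_def simp flip: ennreal_mult)
  also have "\<dots> = ennreal (- Q x x) * ennreal (1 / - Q x x)"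
    by (simp add: nn_integral_multc nn_integral_off_diagonal del: minus_divide_left)
  also have "\<dots> = 1"
    using diagonal[of x] by (simp flip: ennreal_mult)
  finally show ?thesis .
qed

text \<open>The probability that the jump chain started in \<open>x\<close> is in \<open>y\<close> at step \<open>n\<close> and has not been in \<open>x\<close> at
  any of the steps \<open>1, \<dots>, n\<close>.\<close>

fun taboo :: "'a \<Rightarrow> nat \<Rightarrow> 'a \<Rightarrow> ennreal" where
  "taboo x 0 y = (if y = x then 1 else 0)"
| "taboo x (Suc n) y =
     (if y = x then 0 else \<integral>\<^sup>+z. taboo x n z * ennreal (jump_prob Q z y) \<partial>count_space UNIV)"

text \<open>The expected number of visits to \<open>y\<close> before the jump chain returns to \<open>x\<close>; the visit to \<open>x\<close> at
  step \<open>0\<close> counts.\<close>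

definition green :: "'a \<Rightarrow> 'a \<Rightarrow> ennreal" where
  "green x y = (\<Sum>n. taboo x n y)"

lemma green_self: "green x x = 1"
proof -
  have "taboo x n x = (if n = 0 then 1 else 0)" for n by (cases n) auto
  then have "green x x = (\<Sum>n. if n = 0 then 1 else 0)" unfolding green_def by simp
  also have "\<dots> = 1" by (subst suminf_finite[of "{0}"]) auto
  finally show ?thesis .
qed

lemma green_balance:
  assumes "y \<noteq> x"
  shows "green x y = (\<integral>\<^sup>+z. green x z * ennreal (jump_prob Q z y) \<partial>count_space UNIV)"
proof -
  have "green x y = (\<Sum>n. taboo x (Suc n) y) + taboo x 0 y"
    unfolding green_def
    by (subst suminf_offset[of "\<lambda>n. taboo x n y" 1]) (use assms in auto)
  also have "\<dots> = (\<Sum>n. \<integral>\<^sup>+z. taboo x n z * ennreal (jump_prob Q z y) \<partial>count_space UNIV)"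
    using assms by simp
  also have "\<dots> = (\<integral>\<^sup>+z. (\<Sum>n. taboo x n z * ennreal (jump_prob Q z y)) \<partial>count_space UNIV)"
    by (subst nn_integral_suminf) auto
  also have "\<dots> = (\<integral>\<^sup>+z. green x z * ennreal (jump_prob Q z y) \<partial>count_space UNIV)"
    unfolding green_def by (simp add: ennreal_suminf_multc)
  finally show ?thesis .
qed

text \<open>The bound passes from the visits in the first \<open>N\<close> steps to those in the first \<open>N + 1\<close> steps,
  because one step of the jump chain does not increase \<open>\<nu>\<close>.\<close>

lemma green_le_excessive:
  assumes exc: "\<And>y. (\<integral>\<^sup>+z. \<nu> z * ennreal (jump_prob Q z y) \<partial>count_space UNIV) \<le> \<nu> y"
  shows "green x y * \<nu> x \<le> \<nu> y"
proof -
  have partial: "(\<Sum>n<N. taboo x n y) * \<nu> x \<le> \<nu> y" for N y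
  proof (induction N arbitrary: y)
    case 0
    then show ?case by simp
  next
    case (Suc N)
    show ?case
    proof (cases "y = x")
      case True
      have "(\<Sum>n<Suc N. taboo x n x) = 1"
        by (subst sum.lessThan_Suc_shift) simp
      then show ?thesis using True by simp
    next
      case False
      have "(\<Sum>n<Suc N. taboo x n y) * \<nu> x =
          (\<integral>\<^sup>+z. (\<Sum>n<N. taboo x n z * ennreal (jump_prob Q z y)) \<partial>count_space UNIV) * \<nu> x"
        using False by (subst sum.lessThan_Suc_shift, subst nn_integral_sum) auto
      also have "\<dots> = (\<integral>\<^sup>+z. ((\<Sum>n<N. taboo x n z) * \<nu> x) * ennreal (jump_prob Q z y)
          \<partial>count_space UNIV)"
        by (subst nn_integral_multc[symmetric]) (auto simp: sum_distrib_left sum_distrib_right mult_ac)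
      also have "\<dots> \<le> (\<integral>\<^sup>+z. \<nu> z * ennreal (jump_prob Q z y) \<partial>count_space UNIV)"
        by (intro nn_integral_mono mult_right_mono Suc) auto
      also have "\<dots> \<le> \<nu> y" by (rule exc)
      finally show ?thesis .
    qed
  qed
  have "green x y * \<nu> x = (SUP N. (\<Sum>n<N. taboo x n y) * \<nu> x)"
    unfolding green_def suminf_eq_SUP by (rule SUP_mult_right_ennreal)
  also have "\<dots> \<le> \<nu> y" by (rule SUP_least) (rule partial)
  finally show ?thesis .
qed

end

section \<open>Law of the jump chain and the holding times\<close>

text \<open>The successive states \<open>Y\<close> and holding times \<open>S\<close> of the chain with generator \<open>Q\<close> started in \<open>x\<close>, with
  their joint law given on cylinder sets.\<close>

locale jump_chain = conservative Q + prob_space M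
  for Q :: "'a::countable \<Rightarrow> 'a \<Rightarrow> real" and M :: "'w measure" +
  fixes x :: 'a and Y :: "nat \<Rightarrow> 'w \<Rightarrow> 'a" and S :: "nat \<Rightarrow> 'w \<Rightarrow> real"
  assumes Y_measurable[measurable]: "\<And>k. Y k \<in> measurable M (count_space UNIV)"
    and S_measurable[measurable]: "\<And>k. S k \<in> borel_measurable M"
    and cylinder: "\<And>n y t. (\<And>k. k \<le> n \<Longrightarrow> 0 \<le> t k) \<Longrightarrow>
      measure M {\<omega> \<in> space M. \<forall>k\<le>n. Y k \<omega> = y k \<and> t k < S k \<omega>} =
        (if y 0 = x then 1 else 0) * (\<Prod>k<n. jump_prob Q (y k) (y (Suc k)))
        * (\<Prod>k\<le>n. exp (Q (y k) (y k) * t k))"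
begin

lemma emeasure_cylinder_Suc:
  assumes "0 \<le> t"
  shows "emeasure M {\<omega> \<in> space M. (\<forall>k\<le>n. Y k \<omega> = y k \<and> 0 < S k \<omega>) \<and>
           Y (Suc n) \<omega> = z \<and> t < S (Suc n) \<omega>} =
         emeasure M {\<omega> \<in> space M. \<forall>k\<le>n. Y k \<omega> = y k \<and> 0 < S k \<omega>}
           * (ennreal (jump_prob Q (y n) z) * ennreal (exp (Q z z * t)))"
proof -
  let ?y = "y(Suc n := z)" and ?t = "(\<lambda>_. 0)(Suc n := t)"
  have "{\<omega> \<in> space M. (\<forall>k\<le>n. Y k \<omega> = y k \<and> 0 < S k \<omega>) \<and>
           Y (Suc n) \<omega> = z \<and> t < S (Suc n) \<omega>} =
      {\<omega> \<in> space M. \<forall>k\<le>Suc n. Y k \<omega> = ?y k \<and> ?t k < S k \<omega>}"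
    by (auto simp: le_Suc_eq)
  moreover have "measure M {\<omega> \<in> space M. \<forall>k\<le>Suc n. Y k \<omega> = ?y k \<and> ?t k < S k \<omega>} =
      (if y 0 = x then 1 else 0) * (\<Prod>k<n. jump_prob Q (y k) (y (Suc k)))
        * jump_prob Q (y n) z * exp (Q z z * t)"
    by (subst cylinder) (use assms in \<open>auto simp: atMost_Suc\<close>)
  moreover have "measure M {\<omega> \<in> space M. \<forall>k\<le>n. Y k \<omega> = y k \<and> 0 < S k \<omega>} =
      (if y 0 = x then 1 else 0) * (\<Prod>k<n. jump_prob Q (y k) (y (Suc k)))"
    by (subst cylinder) auto
  ultimately show ?thesis
    using jump_prob_nonneg
    by (simp add: emeasure_eq_measure prod_nonneg mult.assoc flip: ennreal_mult)
qed

lemma sum_over_state: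
  assumes [measurable]: "Measurable.pred M P"
  shows "emeasure M {\<omega> \<in> space M. P \<omega>} =
    (\<integral>\<^sup>+u. emeasure M {\<omega> \<in> space M. Y n \<omega> = u \<and> P \<omega>} \<partial>count_space UNIV)"
proof -
  have "{\<omega> \<in> space M. P \<omega>} = (\<Union>u. {\<omega> \<in> space M. Y n \<omega> = u \<and> P \<omega>})" by auto
  moreover have "emeasure M (\<Union>u. {\<omega> \<in> space M. Y n \<omega> = u \<and> P \<omega>}) =
      (\<integral>\<^sup>+u. emeasure M {\<omega> \<in> space M. Y n \<omega> = u \<and> P \<omega>} \<partial>count_space UNIV)"
    by (rule emeasure_UN_countable) (auto simp: disjoint_family_on_def)
  ultimately show ?thesis by simp
qed

lemma sum_over_paths:
  assumes [measurable]: "Measurable.pred M P"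
    and D: "\<And>f g. (\<And>k. k \<le> n \<Longrightarrow> f k = g k) \<Longrightarrow> D f = D g"
  shows "emeasure M {\<omega> \<in> space M. D (\<lambda>k. Y k \<omega>) \<and> P \<omega>} =
    (\<integral>\<^sup>+y. emeasure M {\<omega> \<in> space M. (\<forall>k\<le>n. Y k \<omega> = y k) \<and> P \<omega>}
      \<partial>count_space {y \<in> PiE {..n} (\<lambda>_. UNIV). D y})"
proof -
  let ?C = "{y \<in> PiE {..n} (\<lambda>_. UNIV :: 'a set). D y}"
  let ?E = "\<lambda>y. {\<omega> \<in> space M. (\<forall>k\<le>n. Y k \<omega> = y k) \<and> P \<omega>}"
  have "countable ?C"
    by (rule countable_subset[OF _ countable_PiE[of "{..n}" "\<lambda>_. UNIV"]]) auto
  moreover have "disjoint_family_on ?E ?C"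
    unfolding disjoint_family_on_def
  proof (intro ballI impI)
    fix f g assume fg: "f \<in> ?C" "g \<in> ?C" "f \<noteq> g"
    have "\<exists>k\<le>n. f k \<noteq> g k"
    proof (rule ccontr)
      assume "\<not> (\<exists>k\<le>n. f k \<noteq> g k)"
      then have "f = g" using fg by (intro PiE_ext[of f "{..n}" "\<lambda>_. UNIV"]) auto
      then show False using fg by simp
    qed
    then show "?E f \<inter> ?E g = {}" by auto
  qed
  ultimately have "emeasure M (\<Union>(?E ` ?C)) = (\<integral>\<^sup>+y. emeasure M (?E y) \<partial>count_space ?C)"
    by (intro emeasure_UN_countable) auto
  moreover have "\<Union>(?E ` ?C) = {\<omega> \<in> space M. D (\<lambda>k. Y k \<omega>) \<and> P \<omega>}"
  proof (intro set_eqI iffI)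
    fix \<omega> assume "\<omega> \<in> \<Union>(?E ` ?C)"
    then obtain y where "D y" "\<omega> \<in> ?E y" by auto
    then show "\<omega> \<in> {\<omega> \<in> space M. D (\<lambda>k. Y k \<omega>) \<and> P \<omega>}" using D[of y "\<lambda>k. Y k \<omega>"] by auto
  next
    fix \<omega> assume \<omega>: "\<omega> \<in> {\<omega> \<in> space M. D (\<lambda>k. Y k \<omega>) \<and> P \<omega>}"
    then have "D (restrict (\<lambda>k. Y k \<omega>) {..n})"
      using D[of "restrict (\<lambda>k. Y k \<omega>) {..n}" "\<lambda>k. Y k \<omega>"] by auto
    with \<omega> show "\<omega> \<in> \<Union>(?E ` ?C)"
      by (intro UN_I[of "restrict (\<lambda>k. Y k \<omega>) {..n}"]) auto
  qed
  ultimately show ?thesis by simp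
qed

text \<open>The Markov property at step \<open>n\<close>. The predicate \<open>D\<close> describes an event of the states up to step \<open>n\<close>;
  the event is split into the countably many paths of length \<open>n\<close>, on each of which the cylinder
  formula applies.\<close>

lemma markov_step:
  assumes D: "\<And>f g. (\<And>k. k \<le> n \<Longrightarrow> f k = g k) \<Longrightarrow> D f = D g" and "0 \<le> t"
  shows "emeasure M {\<omega> \<in> space M. (D (\<lambda>k. Y k \<omega>) \<and> Y n \<omega> = u) \<and> (\<forall>k\<le>n. 0 < S k \<omega>) \<and>
           Y (Suc n) \<omega> = z \<and> t < S (Suc n) \<omega>} =
         emeasure M {\<omega> \<in> space M. (D (\<lambda>k. Y k \<omega>) \<and> Y n \<omega> = u) \<and> (\<forall>k\<le>n. 0 < S k \<omega>)}
           * (ennreal (jump_prob Q u z) * ennreal (exp (Q z z * t)))"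
proof -
  let ?D = "\<lambda>f. D f \<and> f n = u"
  have D': "\<And>f g. (\<And>k. k \<le> n \<Longrightarrow> f k = g k) \<Longrightarrow> ?D f = ?D g" using D by (metis order_refl)
  let ?C = "{y \<in> PiE {..n} (\<lambda>_. UNIV :: 'a set). ?D y}"
  have eq: "emeasure M {\<omega> \<in> space M. (\<forall>k\<le>n. Y k \<omega> = y k) \<and> (\<forall>k\<le>n. 0 < S k \<omega>) \<and>
           Y (Suc n) \<omega> = z \<and> t < S (Suc n) \<omega>} =
         emeasure M {\<omega> \<in> space M. (\<forall>k\<le>n. Y k \<omega> = y k) \<and> (\<forall>k\<le>n. 0 < S k \<omega>)}
           * (ennreal (jump_prob Q u z) * ennreal (exp (Q z z * t)))" if "y \<in> ?C" for y
  proof -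
    have e1: "{\<omega> \<in> space M. (\<forall>k\<le>n. Y k \<omega> = y k) \<and> (\<forall>k\<le>n. 0 < S k \<omega>) \<and>
           Y (Suc n) \<omega> = z \<and> t < S (Suc n) \<omega>} = {\<omega> \<in> space M. (\<forall>k\<le>n. Y k \<omega> = y k \<and> 0 < S k \<omega>) \<and>
           Y (Suc n) \<omega> = z \<and> t < S (Suc n) \<omega>}" by auto
    have e2: "{\<omega> \<in> space M. (\<forall>k\<le>n. Y k \<omega> = y k) \<and> (\<forall>k\<le>n. 0 < S k \<omega>)} =
      {\<omega> \<in> space M. \<forall>k\<le>n. Y k \<omega> = y k \<and> 0 < S k \<omega>}" by auto
    have "y n = u" using that by auto
    then show ?thesis using emeasure_cylinder_Suc[OF \<open>0 \<le> t\<close>, of n y z]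
      unfolding e1 e2 by simp
  qed
  have "emeasure M {\<omega> \<in> space M. ?D (\<lambda>k. Y k \<omega>) \<and> (\<forall>k\<le>n. 0 < S k \<omega>) \<and>
           Y (Suc n) \<omega> = z \<and> t < S (Suc n) \<omega>} =
     (\<integral>\<^sup>+y. emeasure M {\<omega> \<in> space M. (\<forall>k\<le>n. Y k \<omega> = y k) \<and> (\<forall>k\<le>n. 0 < S k \<omega>) \<and>
           Y (Suc n) \<omega> = z \<and> t < S (Suc n) \<omega>} \<partial>count_space ?C)"
    by (rule sum_over_paths[OF _ D']) measurable
  also have "\<dots> = (\<integral>\<^sup>+y. emeasure M {\<omega> \<in> space M. (\<forall>k\<le>n. Y k \<omega> = y k) \<and> (\<forall>k\<le>n. 0 < S k \<omega>)}
           * (ennreal (jump_prob Q u z) * ennreal (exp (Q z z * t))) \<partial>count_space ?C)"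
    by (intro nn_integral_cong eq) simp
  also have "\<dots> = (\<integral>\<^sup>+y. emeasure M {\<omega> \<in> space M. (\<forall>k\<le>n. Y k \<omega> = y k) \<and> (\<forall>k\<le>n. 0 < S k \<omega>)}
           \<partial>count_space ?C) * (ennreal (jump_prob Q u z) * ennreal (exp (Q z z * t)))"
    by (rule nn_integral_multc) simp
  also have "(\<integral>\<^sup>+y. emeasure M {\<omega> \<in> space M. (\<forall>k\<le>n. Y k \<omega> = y k) \<and> (\<forall>k\<le>n. 0 < S k \<omega>)}
           \<partial>count_space ?C) =
      emeasure M {\<omega> \<in> space M. ?D (\<lambda>k. Y k \<omega>) \<and> (\<forall>k\<le>n. 0 < S k \<omega>)}"
    by (rule sum_over_paths[OF _ D', symmetric]) measurable
  finally show ?thesis .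
qed

lemma emeasure_start:
  assumes "0 \<le> t"
  shows "emeasure M {\<omega> \<in> space M. Y 0 \<omega> = u \<and> t < S 0 \<omega>} =
    (if u = x then ennreal (exp (Q u u * t)) else 0)"
  using cylinder[of 0 "\<lambda>_. t" "\<lambda>_. u"] assms by (simp add: emeasure_eq_measure)

text \<open>The cylinder formula gives probabilities only for states together with lower bounds on the
  holding times. At the bounds \<open>0\<close>, these probabilities sum to one over all paths, and hence the
  holding times are almost surely positive.\<close>

lemma emeasure_holding_times_pos: "emeasure M {\<omega> \<in> space M. \<forall>k\<le>n. 0 < S k \<omega>} = 1"
proof (induction n)
  case 0
  have "emeasure M {\<omega> \<in> space M. 0 < S 0 \<omega>} =
      (\<integral>\<^sup>+u. (if u = x then 1 else 0) \<partial>count_space UNIV)"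
    by (subst sum_over_state[where n = 0]) (auto simp: emeasure_start intro!: nn_integral_cong)
  also have "\<dots> = (\<integral>\<^sup>+u. indicator {x} u \<partial>count_space UNIV)"
    by (intro nn_integral_cong) auto
  also have "\<dots> = 1" by simp
  finally show ?case by simp
next
  case (Suc n)
  let ?N = "\<lambda>u. emeasure M {\<omega> \<in> space M. Y n \<omega> = u \<and> (\<forall>k\<le>n. 0 < S k \<omega>)}"
  have "emeasure M {\<omega> \<in> space M. \<forall>k\<le>Suc n. 0 < S k \<omega>} =
     (\<integral>\<^sup>+u. emeasure M {\<omega> \<in> space M. Y n \<omega> = u \<and> (\<forall>k\<le>Suc n. 0 < S k \<omega>)} \<partial>count_space UNIV)"
    by (rule sum_over_state) measurable
  also have "\<dots> = (\<integral>\<^sup>+u. \<integral>\<^sup>+z. emeasure M {\<omega> \<in> space M. Y (Suc n) \<omega> = z \<and>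
      Y n \<omega> = u \<and> (\<forall>k\<le>Suc n. 0 < S k \<omega>)} \<partial>count_space UNIV \<partial>count_space UNIV)"
    by (intro nn_integral_cong sum_over_state) measurable
  also have "\<dots> = (\<integral>\<^sup>+u. \<integral>\<^sup>+z. ?N u * ennreal (jump_prob Q u z) \<partial>count_space UNIV \<partial>count_space UNIV)"
  proof (intro nn_integral_cong)
    fix u z
    have "{\<omega> \<in> space M. Y (Suc n) \<omega> = z \<and> Y n \<omega> = u \<and> (\<forall>k\<le>Suc n. 0 < S k \<omega>)} =
      {\<omega> \<in> space M. (True \<and> Y n \<omega> = u) \<and> (\<forall>k\<le>n. 0 < S k \<omega>) \<and>
           Y (Suc n) \<omega> = z \<and> 0 < S (Suc n) \<omega>}" by (auto simp: le_Suc_eq)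
    then show "emeasure M {\<omega> \<in> space M. Y (Suc n) \<omega> = z \<and> Y n \<omega> = u \<and> (\<forall>k\<le>Suc n. 0 < S k \<omega>)} =
      ?N u * ennreal (jump_prob Q u z)"
      using markov_step[where D = "\<lambda>_. True" and n = n and t = 0 and u = u and z = z] by simp
  qed
  also have "\<dots> = (\<integral>\<^sup>+u. ?N u \<partial>count_space UNIV)"
    by (simp add: nn_integral_cmult nn_integral_jump_prob)
  also have "\<dots> = emeasure M {\<omega> \<in> space M. \<forall>k\<le>n. 0 < S k \<omega>}"
    by (rule sum_over_state[symmetric]) measurable
  also have "\<dots> = 1" by (rule Suc)
  finally show ?case .
qed

lemma AE_holding_times_pos: "AE \<omega> in M. \<forall>k. 0 < S k \<omega>"
proof -
  have "AE \<omega> in M. \<forall>k\<le>n. 0 < S k \<omega>" for n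
  proof -
    have "AE \<omega> in M. \<omega> \<in> {\<omega> \<in> space M. \<forall>k\<le>n. 0 < S k \<omega>}"
      by (rule AE_prob_1) (use emeasure_holding_times_pos[of n] in \<open>simp add: measure_def\<close>)
    then show ?thesis by eventually_elim auto
  qed
  then have "AE \<omega> in M. \<forall>n. \<forall>k\<le>n. 0 < S k \<omega>" unfolding AE_all_countable by blast
  then show ?thesis by eventually_elim auto
qed

lemma AE_start: "AE \<omega> in M. Y 0 \<omega> = x"
proof -
  have "AE \<omega> in M. \<omega> \<in> {\<omega> \<in> space M. Y 0 \<omega> = x \<and> 0 < S 0 \<omega>}"
    by (rule AE_prob_1) (use emeasure_start[of 0 x] in \<open>simp add: measure_def\<close>)
  then show ?thesis by eventually_elim auto
qed

lemma AE_moves: "AE \<omega> in M. \<forall>n. Y (Suc n) \<omega> \<noteq> Y n \<omega>"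
proof -
  have "AE \<omega> in M. \<not> (Y n \<omega> = u \<and> (\<forall>k\<le>n. 0 < S k \<omega>) \<and> Y (Suc n) \<omega> = u \<and> 0 < S (Suc n) \<omega>)" for n u
  proof (rule AE_I[OF _ _ ])
    show "emeasure M {\<omega> \<in> space M. (True \<and> Y n \<omega> = u) \<and> (\<forall>k\<le>n. 0 < S k \<omega>) \<and>
           Y (Suc n) \<omega> = u \<and> 0 < S (Suc n) \<omega>} = 0"
      using markov_step[where D = "\<lambda>_. True" and n = n and t = 0 and u = u and z = u]
      by (simp add: jump_prob_def)
  qed auto
  then have "AE \<omega> in M. \<forall>n u. \<not> (Y n \<omega> = u \<and> (\<forall>k\<le>n. 0 < S k \<omega>) \<and> Y (Suc n) \<omega> = u \<and> 0 < S (Suc n) \<omega>)"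
    unfolding AE_all_countable by blast
  with AE_holding_times_pos show ?thesis by eventually_elim blast
qed

text \<open>The path \<open>f\<close> starts in \<open>x\<close> and is not in \<open>x\<close> at any of the steps \<open>1, \<dots>, n\<close>.\<close>

definition before_return :: "nat \<Rightarrow> (nat \<Rightarrow> 'a) \<Rightarrow> bool" where
  "before_return n f \<longleftrightarrow> f 0 = x \<and> (\<forall>k\<in>{1..n}. f k \<noteq> x)"

lemma before_return_cong: "(\<And>k. k \<le> n \<Longrightarrow> f k = g k) \<Longrightarrow> before_return n f = before_return n g"
  by (auto simp: before_return_def)

lemma before_return_measurable[measurable]:
  "Measurable.pred M (\<lambda>\<omega>. before_return n (\<lambda>k. Y k \<omega>))"
  unfolding before_return_def by measurable

lemma emeasure_before_return:
  assumes "0 \<le> t"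
  shows "emeasure M {\<omega> \<in> space M. Y n \<omega> = u \<and> (before_return n (\<lambda>k. Y k \<omega>) \<and>
      (\<forall>k\<le>n. 0 < S k \<omega>) \<and> t < S n \<omega>)} = taboo x n u * ennreal (exp (Q u u * t))"
  using assms
proof (induction n arbitrary: u t)
  case 0
  have "{\<omega> \<in> space M. Y 0 \<omega> = u \<and> (before_return 0 (\<lambda>k. Y k \<omega>) \<and> (\<forall>k\<le>0. 0 < S k \<omega>) \<and> t < S 0 \<omega>)} =
     (if u = x then {\<omega> \<in> space M. Y 0 \<omega> = u \<and> t < S 0 \<omega>} else {})"
    (is "?E = _") using 0 by (auto simp: before_return_def)
  then have "emeasure M ?E = (if u = x then ennreal (exp (Q u u * t)) else 0)"
    using emeasure_start[OF 0, of u] by (simp only: split: if_splits) simp_all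
  then show ?case by simp
next
  case (Suc n)
  show ?case
  proof (cases "u = x")
    case True
    have "{\<omega> \<in> space M. Y (Suc n) \<omega> = u \<and> (before_return (Suc n) (\<lambda>k. Y k \<omega>) \<and>
        (\<forall>k\<le>Suc n. 0 < S k \<omega>) \<and> t < S (Suc n) \<omega>)} = {}" (is "?E = _")
      using True by (auto simp: before_return_def)
    then have "emeasure M ?E = 0" by (simp only: emeasure_empty)
    then show ?thesis using True by simp
  next
    case False
    let ?D = "\<lambda>\<omega>. before_return n (\<lambda>k. Y k \<omega>)"
    have "{\<omega> \<in> space M. Y (Suc n) \<omega> = u \<and> (before_return (Suc n) (\<lambda>k. Y k \<omega>) \<and>
        (\<forall>k\<le>Suc n. 0 < S k \<omega>) \<and> t < S (Suc n) \<omega>)} =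
      {\<omega> \<in> space M. ?D \<omega> \<and> (\<forall>k\<le>n. 0 < S k \<omega>) \<and> Y (Suc n) \<omega> = u \<and> t < S (Suc n) \<omega>}"
      using False Suc.prems by (auto simp: before_return_def atLeastAtMostSuc_conv le_Suc_eq)
    also have "emeasure M \<dots> = (\<integral>\<^sup>+v. emeasure M {\<omega> \<in> space M. Y n \<omega> = v \<and>
       (?D \<omega> \<and> (\<forall>k\<le>n. 0 < S k \<omega>) \<and> Y (Suc n) \<omega> = u \<and> t < S (Suc n) \<omega>)} \<partial>count_space UNIV)"
      by (rule sum_over_state) measurable
    also have "\<dots> = (\<integral>\<^sup>+v. taboo x n v * ennreal (jump_prob Q v u) * ennreal (exp (Q u u * t))
        \<partial>count_space UNIV)"
    proof (intro nn_integral_cong)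
      fix v
      have "{\<omega> \<in> space M. Y n \<omega> = v \<and>
          (?D \<omega> \<and> (\<forall>k\<le>n. 0 < S k \<omega>) \<and> Y (Suc n) \<omega> = u \<and> t < S (Suc n) \<omega>)} =
        {\<omega> \<in> space M. (?D \<omega> \<and> Y n \<omega> = v) \<and> (\<forall>k\<le>n. 0 < S k \<omega>) \<and> Y (Suc n) \<omega> = u \<and> t < S (Suc n) \<omega>}"
        by auto
      also have "emeasure M \<dots> = emeasure M {\<omega> \<in> space M. (?D \<omega> \<and> Y n \<omega> = v) \<and> (\<forall>k\<le>n. 0 < S k \<omega>)}
           * (ennreal (jump_prob Q v u) * ennreal (exp (Q u u * t)))"
        by (rule markov_step[OF before_return_cong Suc.prems])
      also have "{\<omega> \<in> space M. (?D \<omega> \<and> Y n \<omega> = v) \<and> (\<forall>k\<le>n. 0 < S k \<omega>)} =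
         {\<omega> \<in> space M. Y n \<omega> = v \<and> (?D \<omega> \<and> (\<forall>k\<le>n. 0 < S k \<omega>) \<and> 0 < S n \<omega>)}" by auto
      also have "emeasure M \<dots> = taboo x n v" using Suc.IH[of 0 v] by simp
      finally show "emeasure M {\<omega> \<in> space M. Y n \<omega> = v \<and>
          (?D \<omega> \<and> (\<forall>k\<le>n. 0 < S k \<omega>) \<and> Y (Suc n) \<omega> = u \<and> t < S (Suc n) \<omega>)} =
          taboo x n v * ennreal (jump_prob Q v u) * ennreal (exp (Q u u * t))"
        by (simp add: mult.assoc)
    qed
    also have "\<dots> = taboo x (Suc n) u * ennreal (exp (Q u u * t))"
      using False by (simp add: nn_integral_multc)
    finally show ?thesis .
  qed
qed

lemma nn_integral_exp_tail:
  "(\<integral>\<^sup>+t. ennreal (exp (Q u u * t)) * indicator {0..} t \<partial>lborel) = ennreal (1 / - Q u u)"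
proof -
  have "(\<integral>\<^sup>+t. ennreal (exp (Q u u * t)) * indicator {0..} t \<partial>lborel) =
      ennreal (0 - (\<lambda>t. exp (Q u u * t) / Q u u) 0)"
  proof (rule nn_integral_FTC_atLeast)
    show "((\<lambda>t. exp (Q u u * t) / Q u u) has_real_derivative exp (Q u u * t)) (at t)" for t
      using diagonal[of u] by (auto intro!: derivative_eq_intros)
    have "filterlim (\<lambda>t. Q u u * t) at_bot at_top"
      using diagonal[of u] by (simp add: filterlim_tendsto_neg_mult_at_bot[OF tendsto_const] filterlim_ident)
    then have "((\<lambda>t. exp (Q u u * t)) \<longlongrightarrow> 0) at_top"
      by (rule filterlim_compose[OF exp_at_bot])
    from tendsto_divide[OF this tendsto_const[of "Q u u"]] diagonal[of u]
    show "((\<lambda>t. exp (Q u u * t) / Q u u) \<longlongrightarrow> 0) at_top" by simp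
  qed auto
  then show ?thesis by simp
qed

text \<open>The expectation of the holding time is the integral of its tail probabilities, which are
  mixtures of exponential tails.\<close>

lemma expected_holding_time_before_return:
  "(\<integral>\<^sup>+\<omega>. ennreal (S n \<omega>) * indicator {\<omega>. before_return n (\<lambda>k. Y k \<omega>)} \<omega> \<partial>M) =
   (\<integral>\<^sup>+u. taboo x n u * ennreal (1 / - Q u u) \<partial>count_space UNIV)"
proof -
  interpret pair_sigma_finite M lborel ..
  let ?B = "\<lambda>\<omega>. before_return n (\<lambda>k. Y k \<omega>) \<and> (\<forall>k\<le>n. 0 < S k \<omega>)"
  let ?F = "\<lambda>\<omega> t. indicator {0..} t * indicator {\<omega>. ?B \<omega> \<and> t < S n \<omega>} \<omega> :: ennreal"
  have "(\<integral>\<^sup>+\<omega>. ennreal (S n \<omega>) * indicator {\<omega>. before_return n (\<lambda>k. Y k \<omega>)} \<omega> \<partial>M) =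
     (\<integral>\<^sup>+\<omega>. \<integral>\<^sup>+t. ?F \<omega> t \<partial>lborel \<partial>M)"
  proof (rule nn_integral_cong_AE)
    show "AE \<omega> in M. ennreal (S n \<omega>) * indicator {\<omega>. before_return n (\<lambda>k. Y k \<omega>)} \<omega> =
        (\<integral>\<^sup>+t. ?F \<omega> t \<partial>lborel)"
      using AE_holding_times_pos
    proof eventually_elim
      case (elim \<omega>)
      have "(\<integral>\<^sup>+t. ?F \<omega> t \<partial>lborel) =
        (\<integral>\<^sup>+t. indicator {\<omega>. before_return n (\<lambda>k. Y k \<omega>)} \<omega> * indicator {0..<S n \<omega>} t \<partial>lborel)"
        using elim by (intro nn_integral_cong) (auto split: split_indicator)
      also have "\<dots> = indicator {\<omega>. before_return n (\<lambda>k. Y k \<omega>)} \<omega> * ennreal (S n \<omega>)"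
        using elim[rule_format, of n] by (subst nn_integral_cmult_indicator) auto
      finally show ?case by (simp add: mult.commute)
    qed
  qed
  also have "\<dots> = (\<integral>\<^sup>+t. \<integral>\<^sup>+\<omega>. ?F \<omega> t \<partial>M \<partial>lborel)"
    by (rule Fubini'[symmetric]) measurable
  also have "\<dots> = (\<integral>\<^sup>+t. \<integral>\<^sup>+u. taboo x n u * (ennreal (exp (Q u u * t)) * indicator {0..} t)
      \<partial>count_space UNIV \<partial>lborel)"
  proof (intro nn_integral_cong)
    fix t :: real
    have "(\<integral>\<^sup>+\<omega>. ?F \<omega> t \<partial>M) = indicator {0..} t * (\<integral>\<^sup>+\<omega>. indicator {\<omega>. ?B \<omega> \<and> t < S n \<omega>} \<omega> \<partial>M)"
      by (rule nn_integral_cmult) measurable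
    also have "(\<integral>\<^sup>+\<omega>. indicator {\<omega>. ?B \<omega> \<and> t < S n \<omega>} \<omega> \<partial>M) =
        (\<integral>\<^sup>+\<omega>. indicator {\<omega> \<in> space M. ?B \<omega> \<and> t < S n \<omega>} \<omega> \<partial>M)"
      by (intro nn_integral_cong) (auto split: split_indicator)
    also have "\<dots> = emeasure M {\<omega> \<in> space M. ?B \<omega> \<and> t < S n \<omega>}"
      by (rule nn_integral_indicator) measurable
    also have "indicator {0..} t * \<dots> =
        (\<integral>\<^sup>+u. taboo x n u * (ennreal (exp (Q u u * t)) * indicator {0..} t) \<partial>count_space UNIV)"
    proof (cases "0 \<le> t")
      case True
      have "emeasure M {\<omega> \<in> space M. ?B \<omega> \<and> t < S n \<omega>} =
        (\<integral>\<^sup>+u. emeasure M {\<omega> \<in> space M. Y n \<omega> = u \<and> (before_return n (\<lambda>k. Y k \<omega>) \<and>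
          (\<forall>k\<le>n. 0 < S k \<omega>) \<and> t < S n \<omega>)} \<partial>count_space UNIV)"
        by (subst sum_over_state[where n = n]) (auto simp: conj_assoc)
      then show ?thesis using True by (simp add: emeasure_before_return)
    qed simp
    finally show "(\<integral>\<^sup>+\<omega>. ?F \<omega> t \<partial>M) =
      (\<integral>\<^sup>+u. taboo x n u * (ennreal (exp (Q u u * t)) * indicator {0..} t) \<partial>count_space UNIV)" .
  qed
  also have "\<dots> = (\<integral>\<^sup>+u. \<integral>\<^sup>+t. taboo x n u * (ennreal (exp (Q u u * t)) * indicator {0..} t)
      \<partial>lborel \<partial>count_space UNIV)"
    by (rule nn_integral_count_space_nn_integral) auto
  also have "\<dots> = (\<integral>\<^sup>+u. taboo x n u * ennreal (1 / - Q u u) \<partial>count_space UNIV)"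
    by (simp add: nn_integral_cmult nn_integral_exp_tail)
  finally show ?thesis .
qed

end

section \<open>Expected return times\<close>

context jump_chain
begin

text \<open>On a regular path, the return time is the sum of the holding times before the jump chain returns.
  If it never returns, both sides are infinite, since the jump times do not accumulate.\<close>

lemma return_time_eq_suminf:
  fixes X :: "real \<Rightarrow> 'w \<Rightarrow> 'a"
  assumes pos: "\<And>k. 0 < S k \<omega>" and start: "Y 0 \<omega> = x" and moves: "\<And>n. Y (Suc n) \<omega> \<noteq> Y n \<omega>"
    and path: "\<And>t. 0 \<le> t \<Longrightarrow>
      \<exists>n. (\<Sum>k<n. S k \<omega>) \<le> t \<and> t < (\<Sum>k<Suc n. S k \<omega>) \<and> X t \<omega> = Y n \<omega>"
  shows "return_time X x \<omega> =
    (\<Sum>n. ennreal (S n \<omega>) * indicator {\<omega>. before_return n (\<lambda>k. Y k \<omega>)} \<omega>)"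
    (is "_ = (\<Sum>n. ?f n)")
proof -
  define T where "T n = (\<Sum>k<n. S k \<omega>)" for n
  let ?R = "{t. 0 \<le> t \<and> X t \<omega> = x \<and> (\<exists>s\<in>{0..t}. X s \<omega> \<noteq> x)}"
  have mono: "strict_mono T"
    by (rule strict_monoI_Suc) (simp add: T_def pos)
  have T0: "0 \<le> T n" for n unfolding T_def by (intro sum_nonneg less_imp_le pos)
  have path': "\<exists>n. T n \<le> t \<and> t < T (Suc n) \<and> X t \<omega> = Y n \<omega>" if "0 \<le> t" for t
    using path[OF that] unfolding T_def .
  have at_jump: "X (T n) \<omega> = Y n \<omega>" for n
  proof -
    obtain m where m: "T m \<le> T n" "T n < T (Suc m)" "X (T n) \<omega> = Y m \<omega>"
      using path'[OF T0] by blast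
    then have "m = n" using mono by (simp add: strict_mono_less strict_mono_less_eq)
    then show ?thesis using m by simp
  qed
  have partial: "(\<Sum>k<n. ?f k) \<le> ennreal (T n)" for n
  proof -
    have "(\<Sum>k<n. ?f k) \<le> (\<Sum>k<n. ennreal (S k \<omega>))"
      by (intro sum_mono) (auto split: split_indicator)
    then show ?thesis unfolding T_def by (simp add: sum_ennreal pos less_imp_le)
  qed
  have full: "(\<Sum>k<n. ?f k) = ennreal (T n)"
    if "\<And>k. k < n \<Longrightarrow> before_return k (\<lambda>k. Y k \<omega>)" for n
  proof -
    have "(\<Sum>k<n. ?f k) = (\<Sum>k<n. ennreal (S k \<omega>))"
      using that by (intro sum.cong) auto
    then show ?thesis unfolding T_def by (simp add: sum_ennreal pos less_imp_le)
  qed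
  \<comment> \<open>At a time \<open>t\<close> in the set, the jump chain has left \<open>x\<close> and is back in \<open>x\<close> at some step \<open>n\<close>, so
    that only the holding times before step \<open>n\<close> contribute to the sum.\<close>
  have "(\<Sum>n. ?f n) \<le> ennreal t" if R: "t \<in> ?R" for t
  proof -
    obtain s where t: "0 \<le> t" "X t \<omega> = x" and s: "0 \<le> s" "s \<le> t" "X s \<omega> \<noteq> x"
      using R by auto
    obtain n where n: "T n \<le> t" "t < T (Suc n)" "Y n \<omega> = x" using path'[OF t(1)] t(2) by auto
    obtain m where m: "T m \<le> s" "Y m \<omega> \<noteq> x" using path'[OF s(1)] s(3) by auto
    have "T m < T (Suc n)" using m n s by simp
    then have "m \<le> n" using mono by (simp add: strict_mono_less)
    with m n have "m < n" by (metis le_neq_implies_less)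
    then have "\<not> before_return k (\<lambda>k. Y k \<omega>)" if "n \<le> k" for k
      using that n unfolding before_return_def by auto
    then have "(\<Sum>n. ?f n) = (\<Sum>k<n. ?f k)"
      by (intro suminf_finite) (auto simp: not_less)
    also have "\<dots> \<le> ennreal (T n)" by (rule partial)
    also have "\<dots> \<le> ennreal t" using n by (simp add: ennreal_leI)
    finally show ?thesis .
  qed
  then have lower: "(\<Sum>n. ?f n) \<le> return_time X x \<omega>"
    unfolding return_time_def by (intro INF_greatest) auto
  have upper: "return_time X x \<omega> \<le> (\<Sum>n. ?f n)"
  proof (cases "\<exists>n\<ge>1. Y n \<omega> = x")
    case True
    define N where "N = (LEAST n. 1 \<le> n \<and> Y n \<omega> = x)"
    have N: "1 \<le> N" "Y N \<omega> = x" using LeastI_ex[OF True] by (auto simp: N_def)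
    have "Y k \<omega> \<noteq> x" if "1 \<le> k" "k < N" for k
      using not_less_Least[of k "\<lambda>n. 1 \<le> n \<and> Y n \<omega> = x"] that by (auto simp: N_def)
    then have B: "before_return k (\<lambda>k. Y k \<omega>)" if "k < N" for k
      using that start by (auto simp: before_return_def)
    have "X (T 1) \<omega> \<noteq> x" using moves[of 0] start at_jump[of 1] by simp
    moreover have "T 1 \<le> T N" using N mono by (simp add: strict_mono_less_eq)
    ultimately have "T N \<in> ?R" using N at_jump[of N] T0 by auto
    then have "return_time X x \<omega> \<le> ennreal (T N)"
      unfolding return_time_def by (rule INF_lower)
    also have "\<dots> = (\<Sum>k<N. ?f k)" using full[of N] B by simp
    also have "\<dots> \<le> (\<Sum>n. ?f n)" by (rule sum_le_suminf) auto
    finally show ?thesis .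
  next
    case False
    then have B: "before_return k (\<lambda>k. Y k \<omega>)" for k
      using start by (auto simp: before_return_def)
    have ge: "ennreal (T n) \<le> (\<Sum>n. ?f n)" for n
      using full[of n] B sum_le_suminf[of ?f "{..<n}"] by auto
    have "(\<Sum>n. ?f n) = \<infinity>"
    proof (rule ccontr)
      assume "(\<Sum>n. ?f n) \<noteq> \<infinity>"
      then obtain r where r: "0 \<le> r" "(\<Sum>n. ?f n) = ennreal r"
        by (cases "\<Sum>n. ?f n") auto
      obtain n where "r < T (Suc n)" using path'[OF r(1)] by auto
      with ge[of "Suc n"] r T0[of "Suc n"] show False by (simp add: ennreal_le_iff)
    qed
    then show ?thesis by simp
  qed
  show ?thesis using lower upper by (rule antisym[rotated])
qed

lemma expected_return_time:
  assumes "AE \<omega> in M. \<forall>t\<ge>0. \<exists>n. (\<Sum>k<n. S k \<omega>) \<le> t \<and> t < (\<Sum>k<Suc n. S k \<omega>) \<and>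
      X t \<omega> = Y n \<omega>"
  shows "(\<integral>\<^sup>+\<omega>. return_time X x \<omega> \<partial>M) =
    (\<integral>\<^sup>+u. green x u * ennreal (1 / - Q u u) \<partial>count_space UNIV)"
proof -
  have "(\<integral>\<^sup>+\<omega>. return_time X x \<omega> \<partial>M) =
    (\<integral>\<^sup>+\<omega>. (\<Sum>n. ennreal (S n \<omega>) * indicator {\<omega>. before_return n (\<lambda>k. Y k \<omega>)} \<omega>) \<partial>M)"
  proof (rule nn_integral_cong_AE)
    show "AE \<omega> in M. return_time X x \<omega> =
      (\<Sum>n. ennreal (S n \<omega>) * indicator {\<omega>. before_return n (\<lambda>k. Y k \<omega>)} \<omega>)"
      using assms AE_holding_times_pos AE_start AE_moves
      by eventually_elim (rule return_time_eq_suminf, auto)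
  qed
  also have "\<dots> = (\<Sum>n. \<integral>\<^sup>+\<omega>. ennreal (S n \<omega>) *
      indicator {\<omega>. before_return n (\<lambda>k. Y k \<omega>)} \<omega> \<partial>M)"
    by (rule nn_integral_suminf) measurable
  also have "\<dots> = (\<Sum>n. \<integral>\<^sup>+u. taboo x n u * ennreal (1 / - Q u u) \<partial>count_space UNIV)"
    by (simp only: expected_holding_time_before_return)
  also have "\<dots> = (\<integral>\<^sup>+u. (\<Sum>n. taboo x n u * ennreal (1 / - Q u u)) \<partial>count_space UNIV)"
    by (rule nn_integral_suminf[symmetric]) simp
  also have "\<dots> = (\<integral>\<^sup>+u. green x u * ennreal (1 / - Q u u) \<partial>count_space UNIV)"
    unfolding green_def by (simp only: ennreal_suminf_multc)
  finally show ?thesis .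
qed

end

context conservative
begin

lemma markov_chain_expected_return_time:
  assumes "markov_chain Q x M X"
  shows "(\<integral>\<^sup>+\<omega>. return_time X x \<omega> \<partial>M) =
    (\<integral>\<^sup>+u. green x u * ennreal (1 / - Q u u) \<partial>count_space UNIV)"
proof -
  from assms obtain Y :: "nat \<Rightarrow> 'b \<Rightarrow> 'a" and S :: "nat \<Rightarrow> 'b \<Rightarrow> real"
    where M: "prob_space M"
      and Y: "\<And>k. Y k \<in> measurable M (count_space UNIV)" and S: "\<And>k. S k \<in> borel_measurable M"
      and cyl: "\<And>n y t. (\<forall>k\<le>n. 0 \<le> t k) \<Longrightarrow>
           measure M {\<omega> \<in> space M. \<forall>k\<le>n. Y k \<omega> = y k \<and> t k < S k \<omega>} =
             (if y 0 = x then 1 else 0) * (\<Prod>k<n. jump_prob Q (y k) (y (Suc k)))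
             * (\<Prod>k\<le>n. exp (Q (y k) (y k) * t k))"
      and path: "AE \<omega> in M. \<forall>t\<ge>0. \<exists>n. (\<Sum>k<n. S k \<omega>) \<le> t \<and> t < (\<Sum>k<Suc n. S k \<omega>) \<and>
           X t \<omega> = Y n \<omega>"
    unfolding markov_chain_def by blast
  interpret prob_space M by (rule M)
  interpret jump_chain Q M x Y S
    by unfold_locales (use Y S cyl in blast)+
  show ?thesis by (rule expected_return_time[OF path])
qed

section \<open>Summable solutions of the balance equations\<close>

lemma jump_prob_times_exit_rate:
  "- Q z z * jump_prob Q z y = (if z = y then 0 else Q z y)"
  using diagonal[of z] by (auto simp: jump_prob_def)

lemma has_sum_drop_diagonal:
  "((\<lambda>z. h z * Q z y) has_sum 0) UNIV \<longleftrightarrow>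
   ((\<lambda>z. h z * (if z = y then 0 else Q z y)) has_sum h y * - Q y y) UNIV"
proof -
  let ?f = "\<lambda>z. h z * (if z = y then 0 else Q z y)"
  have d: "((\<lambda>z. if z = y then c else 0) has_sum c) UNIV" for c :: real
    by (rule has_sum_finite_neutralI[of "{y}"]) auto
  have e: "(\<lambda>z. h z * Q z y + (if z = y then h y * - Q y y else 0)) = ?f"
    "(\<lambda>z. ?f z + (if z = y then h y * Q y y else 0)) = (\<lambda>z. h z * Q z y)" by auto
  show ?thesis
  proof
    assume "((\<lambda>z. h z * Q z y) has_sum 0) UNIV"
    from has_sum_add[OF this d[of "h y * - Q y y"]] show "(?f has_sum h y * - Q y y) UNIV"
      unfolding e by simp
  next
    assume "(?f has_sum h y * - Q y y) UNIV"
    from has_sum_add[OF this d[of "h y * Q y y"]] show "((\<lambda>z. h z * Q z y) has_sum 0) UNIV"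
      unfolding e by simp
  qed
qed

text \<open>A nonnegative \<open>m\<close> satisfies the balance equation at \<open>y\<close> exactly if the vector of the
  \<open>m z * - Q z z\<close> is preserved at \<open>y\<close> by the jump chain.\<close>

lemma nn_integral_inflow:
  assumes m: "\<And>z. 0 \<le> m z"
  shows "((\<lambda>z. m z * Q z y) has_sum 0) UNIV \<longleftrightarrow>
    (\<integral>\<^sup>+z. ennreal (m z * - Q z z) * ennreal (jump_prob Q z y) \<partial>count_space UNIV) =
      ennreal (m y * - Q y y)"
proof -
  have "(\<integral>\<^sup>+z. ennreal (m z * - Q z z) * ennreal (jump_prob Q z y) \<partial>count_space UNIV) =
    (\<integral>\<^sup>+z. ennreal (m z * (if z = y then 0 else Q z y)) \<partial>count_space UNIV)"
  proof (intro nn_integral_cong)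
    fix z
    show "ennreal (m z * - Q z z) * ennreal (jump_prob Q z y) =
        ennreal (m z * (if z = y then 0 else Q z y))"
      using m[of z] diagonal[of z] jump_prob_nonneg[of z y]
      by (subst ennreal_mult[symmetric])
        (simp_all add: mult.assoc mult_nonneg_nonpos flip: jump_prob_times_exit_rate)
  qed
  moreover have "0 \<le> m y * - Q y y" using m[of y] diagonal[of y] by (intro mult_nonneg_nonneg) auto
  ultimately show ?thesis
    unfolding has_sum_drop_diagonal
    using m off_diagonal by (subst has_sum_iff_nn_integral) auto
qed

lemma finite_expected_return_time:
  assumes m: "\<And>y. 0 \<le> m y" "0 < m x" "m summable_on UNIV"
    and inv: "\<And>y. ((\<lambda>z. m z * Q z y) has_sum 0) UNIV"
  shows "(\<integral>\<^sup>+u. green x u * ennreal (1 / - Q u u) \<partial>count_space UNIV) < \<infinity>"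
proof -
  let ?\<nu> = "\<lambda>y. ennreal (m y * - Q y y)"
  have "(\<integral>\<^sup>+u. green x u * ennreal (1 / - Q u u) \<partial>count_space UNIV) * ?\<nu> x =
      (\<integral>\<^sup>+u. green x u * ?\<nu> x * ennreal (1 / - Q u u) \<partial>count_space UNIV)"
    by (subst nn_integral_multc[symmetric]) (auto simp: mult_ac intro!: nn_integral_cong)
  also have "\<dots> \<le> (\<integral>\<^sup>+u. ?\<nu> u * ennreal (1 / - Q u u) \<partial>count_space UNIV)"
    using inv by (intro nn_integral_mono mult_right_mono green_le_excessive)
      (simp_all add: nn_integral_inflow[OF m(1)] del: mult_minus_right)
  also have "\<dots> = (\<integral>\<^sup>+u. ennreal (m u) \<partial>count_space UNIV)"
  proof (intro nn_integral_cong)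
    fix u
    show "?\<nu> u * ennreal (1 / - Q u u) = ennreal (m u)"
      using m(1)[of u] diagonal[of u]
      by (subst ennreal_mult[symmetric]) (auto simp: mult_nonneg_nonpos)
  qed
  also have "\<dots> = ennreal (infsum m UNIV)"
    using m by (subst has_sum_iff_nn_integral[symmetric]) (auto intro!: infsum_nonneg)
  also have "\<dots> < \<infinity>" by simp
  finally have fin: "(\<integral>\<^sup>+u. green x u * ennreal (1 / - Q u u) \<partial>count_space UNIV) * ?\<nu> x < \<infinity>" .
  have "0 < m x * - Q x x" using m(2) diagonal[of x] by (intro mult_pos_pos) auto
  then have "?\<nu> x \<noteq> 0" by (simp add: ennreal_eq_0_iff not_le del: mult_minus_right)
  show ?thesis
  proof (rule ccontr)
    assume "\<not> ?thesis"
    then have "(\<integral>\<^sup>+u. green x u * ennreal (1 / - Q u u) \<partial>count_space UNIV) = top"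
      by (simp only: infinity_ennreal_def top.not_eq_extremum[symmetric] not_not)
    with fin \<open>?\<nu> x \<noteq> 0\<close> show False by (simp add: ennreal_top_mult)
  qed
qed

text \<open>The witness is the expected time spent in each state before the return to \<open>x\<close>.\<close>

lemma finite_expected_return_time_imp_balance:
  assumes fin: "(\<integral>\<^sup>+u. green x u * ennreal (1 / - Q u u) \<partial>count_space UNIV) < \<infinity>"
  obtains g where "\<And>y. 0 \<le> g y" "0 < g x" "g summable_on UNIV"
    "\<And>y. y \<noteq> x \<Longrightarrow> ((\<lambda>z. g z * Q z y) has_sum 0) UNIV"
proof -
  let ?G = "\<lambda>u. green x u * ennreal (1 / - Q u u)"
  define g where "g u = enn2real (?G u)" for u
  have "?G u \<noteq> \<infinity>" for u
  proof -
    have "AE u in count_space UNIV. ?G u \<noteq> \<infinity>"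
      by (rule nn_integral_PInf_AE) (use fin in auto)
    then show ?thesis by (simp add: AE_count_space)
  qed
  then have G: "?G u = ennreal (g u)" for u by (simp add: g_def less_top)
  have g: "0 \<le> g u" for u by (simp add: g_def)
  have green: "green x u = ennreal (g u * - Q u u)" for u
  proof -
    have "ennreal (g u * - Q u u) = ?G u * ennreal (- Q u u)"
      using g[of u] diagonal[of u] unfolding G by (intro ennreal_mult) auto
    also have "\<dots> = green x u * (ennreal (1 / - Q u u) * ennreal (- Q u u))" by (simp only: mult.assoc)
    also have "ennreal (1 / - Q u u) * ennreal (- Q u u) = 1"
      using diagonal[of u] by (subst ennreal_mult[symmetric]) auto
    finally show ?thesis by simp
  qed
  have "g x \<noteq> 0" using green[of x] green_self[of x] by auto
  then have "0 < g x" using g[of x] by simp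
  moreover have "g summable_on UNIV"
  proof -
    have "(\<integral>\<^sup>+u. ennreal (g u) \<partial>count_space UNIV) < \<infinity>" using fin by (simp only: G)
    then obtain c where "0 \<le> c" "(\<integral>\<^sup>+u. ennreal (g u) \<partial>count_space UNIV) = ennreal c"
      by (cases "\<integral>\<^sup>+u. ennreal (g u) \<partial>count_space UNIV") auto
    then have "(g has_sum c) UNIV" using g by (subst has_sum_iff_nn_integral)
    then show ?thesis by (rule has_sum_imp_summable)
  qed
  moreover have "((\<lambda>z. g z * Q z y) has_sum 0) UNIV" if "y \<noteq> x" for y
    using green_balance[OF that] unfolding nn_integral_inflow[OF g] green ..
  ultimately show ?thesis using that g by blast
qed

text \<open>The triangle inequality gives \<open>\<bar>h y\<bar> * - Q y y \<le> (\<Sum>z\<noteq>y. \<bar>h z\<bar> * Q z y)\<close> for every \<open>y\<close>. Summed over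
  \<open>y\<close>, both sides have the same total, which is finite because the exit rates are bounded. So there
  is equality for each \<open>y\<close>, and a zero of \<open>h\<close> propagates to all states from which it can be reached.\<close>

lemma signed_invariant_eq_0:
  assumes summ: "h summable_on UNIV" and bound: "\<And>y. - Q y y \<le> B"
    and inv: "\<And>y. ((\<lambda>z. h z * Q z y) has_sum 0) UNIV"
    and zero: "h x = 0" and irr: "\<And>z. (z, x) \<in> {(a, b). 0 < Q a b}\<^sup>*"
  shows "h z = 0"
proof -
  let ?off = "\<lambda>z y. if z = y then 0 else Q z y"
  let ?out = "\<lambda>y. ennreal (\<bar>h y\<bar> * - Q y y)"
  let ?in = "\<lambda>y. \<integral>\<^sup>+z. ennreal (\<bar>h z\<bar> * ?off z y) \<partial>count_space UNIV"
  have off: "0 \<le> ?off z y" for z y using off_diagonal by auto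
  have B: "0 \<le> B" using bound[of x] diagonal[of x] by simp
  have abs: "(\<lambda>y. \<bar>h y\<bar>) summable_on UNIV"
    using summ summable_on_iff_abs_summable_on_real[of h UNIV] by simp
  have le: "?out y \<le> ?in y" and fin: "?in y < \<infinity>" for y
  proof -
    have hs: "((\<lambda>z. h z * ?off z y) has_sum h y * - Q y y) UNIV"
      using inv[of y] by (simp only: has_sum_drop_diagonal)
    then have "(\<lambda>z. h z * ?off z y) summable_on UNIV" by (rule has_sum_imp_summable)
    then have s: "(\<lambda>z. norm (h z * ?off z y)) summable_on UNIV"
      by (simp only: summable_on_iff_abs_summable_on_real[symmetric])
    have n: "norm (h z * ?off z y) = \<bar>h z\<bar> * ?off z y" for z
      using off[of z y] by (simp add: abs_mult)
    have "?in y = ennreal (\<Sum>\<^sub>\<infinity>z. \<bar>h z\<bar> * ?off z y)"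
      using s off unfolding n
      by (subst has_sum_iff_nn_integral[symmetric]) (auto intro!: infsum_nonneg)
    moreover have "\<bar>h y\<bar> * - Q y y \<le> (\<Sum>\<^sub>\<infinity>z. \<bar>h z\<bar> * ?off z y)"
      using norm_infsum_bound[OF s] diagonal[of y] unfolding infsumI[OF hs] n
      by (simp add: abs_mult)
    ultimately show "?out y \<le> ?in y" "?in y < \<infinity>" by (simp_all add: ennreal_leI)
  qed
  have "(\<integral>\<^sup>+y. ?in y \<partial>count_space UNIV) =
      (\<integral>\<^sup>+z. \<integral>\<^sup>+y. ennreal \<bar>h z\<bar> * ennreal (?off z y) \<partial>count_space UNIV \<partial>count_space UNIV)"
    using off by (subst nn_integral_count_space_nn_integral) (auto simp: ennreal_mult)
  also have "\<dots> = (\<integral>\<^sup>+z. ?out z \<partial>count_space UNIV)"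
    using diagonal
    by (intro nn_integral_cong)
      (simp add: nn_integral_cmult nn_integral_off_diagonal less_imp_le del: mult_minus_right
        flip: ennreal_mult)
  finally have total: "(\<integral>\<^sup>+y. ?in y \<partial>count_space UNIV) = (\<integral>\<^sup>+z. ?out z \<partial>count_space UNIV)" .
  have "(\<integral>\<^sup>+z. ?out z \<partial>count_space UNIV) \<le> (\<integral>\<^sup>+z. ennreal B * ennreal \<bar>h z\<bar> \<partial>count_space UNIV)"
  proof (intro nn_integral_mono)
    fix z
    have "\<bar>h z\<bar> * - Q z z \<le> B * \<bar>h z\<bar>"
      using mult_left_mono[OF bound[of z] abs_ge_zero[of "h z"]] by (simp only: mult.commute)
    then show "?out z \<le> ennreal B * ennreal \<bar>h z\<bar>"
      using B by (simp add: ennreal_leI flip: ennreal_mult)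
  qed
  also have "\<dots> = ennreal B * ennreal (\<Sum>\<^sub>\<infinity>z. \<bar>h z\<bar>)"
    using abs has_sum_iff_nn_integral[of "\<lambda>z. \<bar>h z\<bar>" "\<Sum>\<^sub>\<infinity>z. \<bar>h z\<bar>"]
    by (simp add: nn_integral_cmult infsum_nonneg)
  finally have out_fin: "(\<integral>\<^sup>+z. ?out z \<partial>count_space UNIV) \<noteq> \<infinity>"
    by (auto simp: ennreal_mult_eq_top_iff top_unique)
  have "(\<integral>\<^sup>+y. ?in y - ?out y \<partial>count_space UNIV) = 0"
    using out_fin le by (subst nn_integral_diff) (auto simp: total AE_count_space)
  then have "?in y - ?out y = 0" for y
    by (subst (asm) nn_integral_0_iff_AE) (auto simp: AE_count_space)
  then have in_le: "?in y \<le> ?out y" for y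
    using fin[of y] by (simp add: diff_eq_0_iff_ennreal)
  have pred: "h a = 0" if "h b = 0" "0 < Q a b" for a b
  proof -
    have "a \<noteq> b" using that diagonal[of b] by auto
    have "?in b = 0" using in_le[of b] that by simp
    then have "ennreal (\<bar>h a\<bar> * ?off a b) = 0"
      by (subst (asm) nn_integral_0_iff_AE) (auto simp: AE_count_space)
    then have "\<bar>h a\<bar> * Q a b \<le> 0" using \<open>a \<noteq> b\<close> by (simp add: ennreal_eq_0_iff)
    then show ?thesis using that(2) by (simp add: mult_le_0_iff)
  qed
  show ?thesis using irr[of z]
    by (induction rule: converse_rtrancl_induct) (use zero pred in auto)
qed

end

section \<open>The inventory chain\<close>

lemma has_sum_single:
  "((\<lambda>z. if P \<and> z = a then c else 0) has_sum (if P then c else 0)) UNIV"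
  for c :: real
  by (rule has_sum_finite_neutralI[of "{a}"]) auto

text \<open>The balance equations reduce to detailed balance \<open>lam * \<pi> (i + 1) = \<beta> * \<pi> i\<close>, and a geometric
  sequence with nonzero sum has a ratio below one.\<close>

lemma inventory_balance:
  assumes "lam > 0" "\<beta> > 0" and inv: "invariant_measure (generator (inventory_rate lam \<beta>)) \<pi>"
  shows "\<beta> < lam" and "\<pi> i = (1 - \<beta> / lam) * (\<beta> / lam) ^ i"
proof -
  have exit: "(\<Sum>\<^sub>\<infinity>z\<in>-{i}. inventory_rate lam \<beta> i z) = \<beta> + (if i \<ge> 1 then lam else 0)" for i
  proof (rule infsumI, rule has_sum_finite_neutralI)
    show "finite ({Suc i} \<union> (if i \<ge> 1 then {i - 1} else {}))" by simp
  qed (auto simp: inventory_rate_def)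
  have column: "((\<lambda>k. \<pi> k * generator (inventory_rate lam \<beta>) k i) has_sum
      (\<pi> (Suc i) * lam + (if i \<ge> 1 then \<pi> (i - 1) * \<beta> else 0) -
        \<pi> i * (\<beta> + (if i \<ge> 1 then lam else 0)))) UNIV" for i
  proof -
    have "((\<lambda>k. (if True \<and> k = Suc i then \<pi> (Suc i) * lam else 0) +
        (if i \<ge> 1 \<and> k = i - 1 then \<pi> (i - 1) * \<beta> else 0) +
        (if True \<and> k = i then - \<pi> i * (\<beta> + (if i \<ge> 1 then lam else 0)) else 0)) has_sum
      ((if True then \<pi> (Suc i) * lam else 0) + (if i \<ge> 1 then \<pi> (i - 1) * \<beta> else 0) +
        (if True then - \<pi> i * (\<beta> + (if i \<ge> 1 then lam else 0)) else 0))) UNIV"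
      by (intro has_sum_add has_sum_single)
    moreover have "(\<lambda>k. (if True \<and> k = Suc i then \<pi> (Suc i) * lam else 0) +
        (if i \<ge> 1 \<and> k = i - 1 then \<pi> (i - 1) * \<beta> else 0) +
        (if True \<and> k = i then - \<pi> i * (\<beta> + (if i \<ge> 1 then lam else 0)) else 0)) =
      (\<lambda>k. \<pi> k * generator (inventory_rate lam \<beta>) k i)"
    proof
      fix k
      have "generator (inventory_rate lam \<beta>) k i =
          (if k = i then - (\<beta> + (if i \<ge> 1 then lam else 0)) else inventory_rate lam \<beta> k i)"
        by (simp add: generator_def exit)
      then show "(if True \<and> k = Suc i then \<pi> (Suc i) * lam else 0) +
          (if i \<ge> 1 \<and> k = i - 1 then \<pi> (i - 1) * \<beta> else 0) +
          (if True \<and> k = i then - \<pi> i * (\<beta> + (if i \<ge> 1 then lam else 0)) else 0) =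
        \<pi> k * generator (inventory_rate lam \<beta>) k i"
        by (auto simp: inventory_rate_def algebra_simps)
    qed
    ultimately show ?thesis by simp
  qed
  have balance: "\<pi> (Suc i) * lam + (if i \<ge> 1 then \<pi> (i - 1) * \<beta> else 0) =
      \<pi> i * (\<beta> + (if i \<ge> 1 then lam else 0))" for i
  proof -
    have "((\<lambda>k. \<pi> k * generator (inventory_rate lam \<beta>) k i) has_sum 0) UNIV"
      using inv unfolding invariant_measure_def by blast
    from has_sum_unique[OF this column] show ?thesis by simp
  qed
  have cut: "\<pi> (Suc i) * lam = \<pi> i * \<beta>" for i
  proof (induction i)
    case 0
    then show ?case using balance[of 0] by simp
  next
    case (Suc i)
    then show ?case using balance[of "Suc i"] by (simp add: algebra_simps)
  qed
  have geo: "\<pi> i = \<pi> 0 * (\<beta> / lam) ^ i" for i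
  proof (induction i)
    case (Suc i)
    have "\<pi> (Suc i) = \<pi> i * (\<beta> / lam)" using cut[of i] assms(1) by (simp add: field_simps)
    then show ?case using Suc by simp
  qed simp
  have "\<pi> sums 1" using inv by (auto simp: invariant_measure_def intro: has_sum_imp_sums)
  then have sums: "(\<lambda>i. \<pi> 0 * (\<beta> / lam) ^ i) sums 1" by (simp flip: geo)
  then have "\<pi> 0 \<noteq> 0" by (auto simp: sums_iff)
  then have "summable (\<lambda>i. (\<beta> / lam) ^ i)"
    using sums_summable[OF sums] by (simp add: summable_cmult_iff)
  then have lt: "\<beta> / lam < 1" using assms by (simp add: summable_geometric_iff)
  then show "\<beta> < lam" using assms by simp
  have "(\<lambda>i. \<pi> 0 * (\<beta> / lam) ^ i) sums (\<pi> 0 * (1 / (1 - \<beta> / lam)))"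
    using lt assms by (intro sums_mult geometric_sums) simp
  from sums_unique2[OF this sums] have "\<pi> 0 = 1 - \<beta> / lam" using lt by (simp add: field_simps)
  then show "\<pi> i = (1 - \<beta> / lam) * (\<beta> / lam) ^ i" by (subst geo) simp
qed

section \<open>The production inventory chain\<close>

lemma conservative_generator:
  fixes r :: "'a::countable \<Rightarrow> 'a \<Rightarrow> real"
  assumes nonneg: "\<And>x y. 0 \<le> r x y"
    and exit: "\<And>x. ((\<lambda>y. r x y) has_sum e x) (- {x})" "\<And>x. 0 < e x"
  shows "conservative (generator r)"
proof
  fix x y :: 'a
  show "0 \<le> generator r x y" if "x \<noteq> y" using that nonneg by (simp add: generator_def)
  have diag: "generator r x x = - e x"
    using infsumI[OF exit(1)[of x]] by (simp add: generator_def)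
  then show "generator r x x < 0" using exit(2)[of x] by simp
  have "((\<lambda>y. generator r x y) has_sum e x) (- {x})"
    using exit(1)[of x] by (rule has_sum_cong[THEN iffD1, rotated]) (auto simp: generator_def)
  from has_sum_insert[OF _ this] have "((\<lambda>y. generator r x y) has_sum (- e x + e x)) (insert x (- {x}))"
    by (simp add: diag)
  also have "insert x (- {x}) = UNIV" by auto
  finally show "((\<lambda>y. generator r x y) has_sum 0) UNIV" by simp
qed

lemma has_sum_geometric_product:
  assumes "0 \<le> a" "a < 1" "0 \<le> b" "b < 1"
  shows "((\<lambda>(n, i). (1 - a) * (1 - b) * a ^ n * b ^ i) has_sum (1::real)) (UNIV :: (nat \<times> nat) set)"
proof -
  let ?f = "\<lambda>(n, i). (1 - a) * (1 - b) * a ^ n * b ^ i"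
  have inner: "((\<lambda>i. ?f (n, i)) has_sum (1 - a) * a ^ n) UNIV" for n
  proof -
    have "(\<lambda>i. (1 - a) * (1 - b) * a ^ n * b ^ i) sums ((1 - a) * (1 - b) * a ^ n * (1 / (1 - b)))"
      using assms by (intro sums_mult geometric_sums) simp
    then have "(\<lambda>i. ?f (n, i)) sums ((1 - a) * a ^ n)" using assms by simp
    then show ?thesis using assms by (intro sums_nonneg_imp_has_sum) auto
  qed
  have outer: "((\<lambda>n. (1 - a) * a ^ n) has_sum 1) UNIV"
  proof -
    have "(\<lambda>n. (1 - a) * a ^ n) sums ((1 - a) * (1 / (1 - a)))"
      using assms by (intro sums_mult geometric_sums) simp
    then show ?thesis using assms by (intro sums_nonneg_imp_has_sum) auto
  qed
  have "?f summable_on (SIGMA n:UNIV. UNIV)"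
    by (rule summable_on_SigmaI[OF inner has_sum_imp_summable[OF outer]]) (use assms in auto)
  from has_sum_SigmaI[OF inner outer this] show ?thesis by simp
qed

text \<open>The chain on pairs of the number of customers and the inventory level; \<open>G\<close> is its generator.\<close>

locale production =
  fixes lam \<mu> \<beta> :: real
  assumes lam_pos: "0 < lam" and mu_pos: "0 < \<mu>" and beta_pos: "0 < \<beta>"
begin

abbreviation G :: "nat \<times> nat \<Rightarrow> nat \<times> nat \<Rightarrow> real" where
  "G \<equiv> generator (production_rate lam \<mu> \<beta>)"

text \<open>The total rate of leaving a state: by an arrival, by a service, and by a production.\<close>

definition exit_rate :: "nat \<times> nat \<Rightarrow> real" where
  "exit_rate = (\<lambda>(n, i). (if i \<ge> 1 then lam else 0) + (if n \<ge> 1 \<and> i \<ge> 1 then \<mu> else 0) + \<beta>)"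

lemma exit_rate: "((\<lambda>y. production_rate lam \<mu> \<beta> x y) has_sum exit_rate x) (- {x})"
proof -
  obtain n i where x: "x = (n, i)" by (cases x)
  let ?A = "if i \<ge> 1 then {(n + 1, i)} else {}"
    and ?B = "if n \<ge> 1 \<and> i \<ge> 1 then {(n - 1, i - 1)} else {}" and ?C = "{(n, i + 1)}"
  show ?thesis
  proof (rule has_sum_finite_neutralI)
    show "finite (?A \<union> ?B \<union> ?C)" by simp
    show "?A \<union> ?B \<union> ?C \<subseteq> - {x}" by (auto simp: x split: if_splits)
    show "exit_rate x = sum (production_rate lam \<mu> \<beta> x) (?A \<union> ?B \<union> ?C)"
      by (auto simp: x exit_rate_def production_rate_def)
  qed (auto simp: x production_rate_def split: if_splits)
qed

lemma exit_rate_pos: "0 < exit_rate x"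
  using lam_pos mu_pos beta_pos by (auto simp: exit_rate_def split: prod.split)

lemma exit_rate_le: "exit_rate x \<le> lam + \<mu> + \<beta>"
  using lam_pos mu_pos beta_pos by (auto simp: exit_rate_def split: prod.split)

lemma diagonal_eq: "G x x = - exit_rate x"
  using infsumI[OF exit_rate[of x]] by (simp add: generator_def)

sublocale conservative G
proof (rule conservative_generator[OF _ exit_rate exit_rate_pos])
  show "0 \<le> production_rate lam \<mu> \<beta> x y" for x y
    using lam_pos mu_pos beta_pos by (auto simp: production_rate_def split: prod.split)
qed

text \<open>The flow under \<open>p\<close> into a state: by a service, by a production, and by an arrival.\<close>

definition inflow :: "(nat \<times> nat \<Rightarrow> real) \<Rightarrow> nat \<times> nat \<Rightarrow> real" where
  "inflow p = (\<lambda>(n, i). p (Suc n, Suc i) * \<mu> + (if i \<ge> 1 then p (n, i - 1) * \<beta> else 0) +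
     (if n \<ge> 1 \<and> i \<ge> 1 then p (n - 1, i) * lam else 0))"

lemma has_sum_column:
  "((\<lambda>z. p z * G z y) has_sum (inflow p y - p y * exit_rate y)) UNIV"
proof -
  obtain n i where y: "y = (n, i)" by (cases y)
  have "((\<lambda>z. (if True \<and> z = (Suc n, Suc i) then p (Suc n, Suc i) * \<mu> else 0) +
      (if i \<ge> 1 \<and> z = (n, i - 1) then p (n, i - 1) * \<beta> else 0) +
      (if (n \<ge> 1 \<and> i \<ge> 1) \<and> z = (n - 1, i) then p (n - 1, i) * lam else 0) +
      (if True \<and> z = (n, i) then - p y * exit_rate y else 0)) has_sum
      ((if True then p (Suc n, Suc i) * \<mu> else 0) +
      (if i \<ge> 1 then p (n, i - 1) * \<beta> else 0) +
      (if n \<ge> 1 \<and> i \<ge> 1 then p (n - 1, i) * lam else 0) +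
      (if True then - p y * exit_rate y else 0))) UNIV"
    by (intro has_sum_add has_sum_single)
  moreover have "(\<lambda>z. (if True \<and> z = (Suc n, Suc i) then p (Suc n, Suc i) * \<mu> else 0) +
      (if i \<ge> 1 \<and> z = (n, i - 1) then p (n, i - 1) * \<beta> else 0) +
      (if (n \<ge> 1 \<and> i \<ge> 1) \<and> z = (n - 1, i) then p (n - 1, i) * lam else 0) +
      (if True \<and> z = (n, i) then - p y * exit_rate y else 0)) = (\<lambda>z. p z * G z y)"
  proof
    fix z :: "nat \<times> nat"
    obtain a b where z: "z = (a, b)" by (cases z)
    consider "z = y" | "z \<noteq> y" by blast
    then show "(if True \<and> z = (Suc n, Suc i) then p (Suc n, Suc i) * \<mu> else 0) +
      (if i \<ge> 1 \<and> z = (n, i - 1) then p (n, i - 1) * \<beta> else 0) +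
      (if (n \<ge> 1 \<and> i \<ge> 1) \<and> z = (n - 1, i) then p (n - 1, i) * lam else 0) +
      (if True \<and> z = (n, i) then - p y * exit_rate y else 0) = p z * G z y"
    proof cases
      case 1
      then show ?thesis using y by (auto simp: diagonal_eq)
    next
      case 2
      then have rate: "G z y = production_rate lam \<mu> \<beta> z y" by (simp add: generator_def)
      show ?thesis
        unfolding rate using 2 unfolding y z production_rate_def
        by (cases a; cases b; cases n; cases i) auto
    qed
  qed
  ultimately show ?thesis by (simp add: inflow_def y)
qed

lemma balance_iff: "((\<lambda>z. p z * G z y) has_sum 0) UNIV \<longleftrightarrow> inflow p y = p y * exit_rate y"
  using has_sum_column[of p y] has_sum_unique by fastforce

lemma geometric_balance:
  assumes lam: "lam = \<rho> * \<mu>" and beta: "\<beta> = r * lam"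
  shows "inflow (\<lambda>(n, i). c * \<rho> ^ n * r ^ i) y = (\<lambda>(n, i). c * \<rho> ^ n * r ^ i) y * exit_rate y"
proof -
  obtain n i where y: "y = (n, i)" by (cases y)
  show ?thesis
    unfolding y inflow_def exit_rate_def
    by (cases n; cases i) (simp_all add: beta lam algebra_simps)
qed

lemma reaches_empty: "(z, (0, 0)) \<in> {(x, y). 0 < G x y}\<^sup>*"
proof -
  let ?R = "{(x, y). 0 < G x y}"
  have join: "((n, Suc i), (Suc n, Suc i)) \<in> ?R" for n i
    using lam_pos by (simp add: generator_def production_rate_def)
  have serve: "((Suc n, Suc i), (n, i)) \<in> ?R" for n i
    using mu_pos by (auto simp: generator_def production_rate_def)
  have produce: "((n, i), (n, Suc i)) \<in> ?R" for n i
    using beta_pos mu_pos by (auto simp: generator_def production_rate_def)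
  have empty: "((n, 0), (0, 0)) \<in> ?R\<^sup>*" for n
  proof (induction n)
    case (Suc n)
    have "((Suc n, 0), (n, 0)) \<in> ?R\<^sup>*"
      using produce[of "Suc n" 0] serve[of n 0] by (rule converse_rtrancl_into_rtrancl[OF _ r_into_rtrancl])
    with Suc show ?case by (rule rtrancl_trans[rotated])
  qed simp
  have "((n, i), (0, 0)) \<in> ?R\<^sup>*" for n i
  proof (induction i arbitrary: n)
    case 0
    show ?case by (rule empty)
  next
    case (Suc i)
    show ?case
    proof (cases n)
      case 0
      have "((0, Suc i), (0, i)) \<in> ?R\<^sup>*"
        using join[of 0 i] serve[of 0 i] by (rule converse_rtrancl_into_rtrancl[OF _ r_into_rtrancl])
      with 0 Suc[of 0] show ?thesis by (metis rtrancl_trans)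
    next
      case (Suc m)
      with Suc.IH[of m] serve[of m i] show ?thesis by (metis converse_rtrancl_into_rtrancl)
    qed
  qed
  then show ?thesis by (cases z) simp
qed

text \<open>
  The integral is the expected return time to \<open>(0, 1)\<close>. In this state the inventory is not empty, so
  it contributes to the mass of level \<open>0\<close>.
\<close>

lemma infinite_expected_return_time:
  assumes "\<mu> \<le> lam"
  shows "(\<integral>\<^sup>+u. green (0, 1) u * ennreal (1 / - G u u) \<partial>count_space UNIV) = \<infinity>"
proof (rule ccontr)
  assume "\<not> ?thesis"
  then have "(\<integral>\<^sup>+u. green (0, 1) u * ennreal (1 / - G u u) \<partial>count_space UNIV) < \<infinity>"
    by (simp only: infinity_ennreal_def top.not_eq_extremum)
  then obtain g where g: "\<And>y. 0 \<le> g y" "0 < g (0, 1)" "g summable_on UNIV"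
    and bal: "\<And>y. y \<noteq> (0, 1) \<Longrightarrow> inflow g y = g y * exit_rate y"
    using finite_expected_return_time_imp_balance[of "(0, 1)"] unfolding balance_iff by blast
  have "g summable_on (SIGMA n:UNIV. UNIV)" using g(3) by simp
  then have "(\<lambda>(n, i). g (n, i)) summable_on (SIGMA n:UNIV. UNIV)" by (simp add: case_prod_unfold)
  note level = summable_on_SigmaD1[OF this UNIV_I]
  define a where "a n = (\<Sum>i. g (n, Suc i))" for n
  define b where "b n = (\<Sum>i. g (n, i))" for n
  have summ: "summable (\<lambda>i. g (n, i))" for n by (rule summable_on_imp_summable[OF level])
  have summ': "summable (\<lambda>i. g (n, Suc i))" for n
    using summ[of n] summable_Suc_iff[of "\<lambda>i. g (n, i)"] by simp
  have ab: "b n = g (n, 0) + a n" for n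
    unfolding a_def b_def using suminf_split_head[OF summ[of n]] by simp
  have "(b has_sum infsum g UNIV) UNIV"
  proof (rule has_sum_SigmaD)
    show "(g has_sum infsum g UNIV) (SIGMA n:UNIV. UNIV)" using g(3) by simp
    show "((\<lambda>i. g (n, i)) has_sum b n) UNIV" for n
      unfolding b_def by (intro sums_nonneg_imp_has_sum summable_sums summ g(1))
  qed
  then have "b sums infsum g UNIV" by (rule has_sum_imp_sums)
  then have b0: "b \<longlonglongrightarrow> 0" by (intro summable_LIMSEQ_zero sums_summable)
  have a_nonneg: "0 \<le> a n" for n unfolding a_def by (intro suminf_nonneg summ' g(1))
  have a_lim: "a \<longlonglongrightarrow> 0"
    by (rule tendsto_sandwich[OF _ _ tendsto_const b0]) (use a_nonneg g(1) in \<open>auto simp: ab\<close>)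
  \<comment> \<open>The balance equations of level \<open>n + 1\<close> are summed over the inventory; production cancels. The
    level \<open>0\<close>, which contains the state \<open>(0, 1)\<close>, is not used.\<close>
  have cut: "a n * lam - a (Suc n) * \<mu> = a 0 * lam - a 1 * \<mu>" for n
  proof (induction n)
    case (Suc n)
    have "(\<lambda>i. g (Suc n, Suc i) * (lam + \<mu> + \<beta>)) sums (a (Suc n) * (lam + \<mu> + \<beta>))"
      unfolding a_def by (intro sums_mult2 summable_sums summ')
    moreover have "g (Suc n, Suc i) * (lam + \<mu> + \<beta>) =
        g (Suc (Suc n), Suc (Suc i)) * \<mu> + g (Suc n, i) * \<beta> + g (n, Suc i) * lam" for i
      using bal[of "(Suc n, Suc i)"] by (simp add: inflow_def exit_rate_def)
    moreover have "(\<lambda>i. g (Suc (Suc n), Suc (Suc i)) * \<mu> + g (Suc n, i) * \<beta> + g (n, Suc i) * lam)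
        sums ((a (Suc (Suc n)) - g (Suc (Suc n), Suc 0)) * \<mu> + b (Suc n) * \<beta> + a n * lam)"
    proof (intro sums_add sums_mult2)
      show "(\<lambda>i. g (Suc n, i)) sums b (Suc n)" unfolding b_def by (intro summable_sums summ)
      show "(\<lambda>i. g (n, Suc i)) sums a n" unfolding a_def by (intro summable_sums summ')
      have "(\<lambda>i. g (Suc (Suc n), Suc i)) sums a (Suc (Suc n))"
        unfolding a_def by (intro summable_sums summ')
      then show "(\<lambda>i. g (Suc (Suc n), Suc (Suc i))) sums (a (Suc (Suc n)) - g (Suc (Suc n), Suc 0))"
        by (subst sums_Suc_iff) simp
    qed
    ultimately have "a (Suc n) * (lam + \<mu> + \<beta>) =
        (a (Suc (Suc n)) - g (Suc (Suc n), Suc 0)) * \<mu> + b (Suc n) * \<beta> + a n * lam"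
      by (simp add: sums_unique2)
    moreover have "g (Suc (Suc n), Suc 0) * \<mu> = g (Suc n, 0) * \<beta>"
      using bal[of "(Suc n, 0)"] by (simp add: inflow_def exit_rate_def)
    ultimately have "a (Suc n) * lam - a (Suc (Suc n)) * \<mu> = a n * lam - a (Suc n) * \<mu>"
      by (simp add: ab algebra_simps)
    then show ?case using Suc by simp
  qed simp
  have "(\<lambda>n. a n * lam - a (Suc n) * \<mu>) \<longlonglongrightarrow> 0 * lam - 0 * \<mu>"
    using a_lim by (intro tendsto_intros filterlim_sequentially_Suc[THEN iffD2])
  then have "a 0 * lam - a 1 * \<mu> = 0"
    unfolding cut by (simp add: LIMSEQ_const_iff)
  with cut have step: "a n * lam = a (Suc n) * \<mu>" for n by simp
  have mono: "a n \<le> a (Suc n)" for n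
  proof -
    have "a n * \<mu> \<le> a n * lam" using assms a_nonneg by (intro mult_left_mono)
    then have "a n * \<mu> \<le> a (Suc n) * \<mu>" by (simp only: step)
    then show ?thesis using mu_pos by simp
  qed
  \<comment> \<open>As \<open>\<mu> \<le> lam\<close>, the sequence \<open>a\<close> increases to its limit \<open>0\<close>.\<close>
  have "g (0, 1) \<le> a 0"
    using sum_le_suminf[OF summ'[of 0], of "{0}"] g(1) unfolding a_def by simp
  moreover have "a 0 \<le> 0"
    using incseq_le[OF incseq_SucI a_lim, of 0] mono by blast
  ultimately show False using g(2) by simp
qed

end

section \<open>Stability and the product form\<close>

theorem theorem3p1:
  fixes lam \<mu> \<beta> \<rho> :: real
    and \<pi> :: "nat \<Rightarrow> real"
    and M :: "nat \<times> nat \<Rightarrow> 'w measure"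
    and X :: "real \<Rightarrow> 'w \<Rightarrow> nat \<times> nat"
  assumes "lam > 0" and "\<mu> > 0" and "\<beta> > 0"
    and "\<beta> < \<mu>" and "lam \<noteq> \<beta>"
    and "\<rho> = lam / \<mu>"
    and inventory: "invariant_measure (generator (inventory_rate lam \<beta>)) \<pi>"
    and chain: "\<And>x. markov_chain (generator (production_rate lam \<mu> \<beta>)) x (M x) X"
  shows "(positive_recurrent M X \<longleftrightarrow> lam < \<mu>) \<and>
    (\<forall>i. \<pi> i = (1 - \<beta> / lam) * (\<beta> / lam) ^ i) \<and>
    (lam < \<mu> \<longrightarrow>
      (\<forall>P :: nat \<times> nat \<Rightarrow> real.
        invariant_measure (generator (production_rate lam \<mu> \<beta>)) P \<longleftrightarrow>
          (\<forall>i. P (0, i) = (1 - \<rho>) * \<pi> i) \<and>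
          (\<forall>n\<ge>1. \<forall>i. P (n, i) = (1 - \<rho>) * \<rho> ^ n * \<pi> i)))"
proof -
  interpret production lam \<mu> \<beta> by unfold_locales (rule assms)+
  have \<pi>: "\<pi> i = (1 - \<beta> / lam) * (\<beta> / lam) ^ i" for i
    by (rule inventory_balance(2)[OF assms(1,3) inventory])
  have "\<beta> < lam" by (rule inventory_balance(1)[OF assms(1,3) inventory])
  define m where "m = (\<lambda>(n, i). (1 - \<rho>) * (1 - \<beta> / lam) * \<rho> ^ n * (\<beta> / lam) ^ i)"
  have m_inv: "invariant_measure G m" and m_pos: "\<And>y. 0 < m y" if "lam < \<mu>"
  proof -
    have \<rho>: "0 < \<rho>" "\<rho> < 1" and r: "0 < \<beta> / lam" "\<beta> / lam < 1"
      using that assms \<open>\<beta> < lam\<close> by auto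
    have "(m has_sum 1) UNIV"
      unfolding m_def by (rule has_sum_geometric_product) (use \<rho> r in auto)
    moreover have "((\<lambda>z. m z * G z y) has_sum 0) UNIV" for y
      unfolding balance_iff m_def by (rule geometric_balance) (use assms in auto)
    ultimately show "invariant_measure G m" by (simp add: invariant_measure_def)
    show "0 < m y" for y using \<rho> r by (auto simp: m_def split: prod.split)
  qed
  have "positive_recurrent M X \<longleftrightarrow> lam < \<mu>"
  proof
    assume "positive_recurrent M X"
    then have "(\<integral>\<^sup>+u. green (0, 1) u * ennreal (1 / - G u u) \<partial>count_space UNIV) < \<infinity>"
      unfolding positive_recurrent_def markov_chain_expected_return_time[OF chain] by blast
    then show "lam < \<mu>" using infinite_expected_return_time by (cases "lam < \<mu>") auto
  next
    assume lt: "lam < \<mu>"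
    show "positive_recurrent M X"
      unfolding positive_recurrent_def markov_chain_expected_return_time[OF chain]
    proof (intro allI finite_expected_return_time[where m = m])
      show "0 \<le> m y" "0 < m y" for y using m_pos[OF lt, of y] by simp_all
      show "m summable_on UNIV" "((\<lambda>z. m z * G z y) has_sum 0) UNIV" for y
        using m_inv[OF lt] unfolding invariant_measure_def by (blast intro: has_sum_imp_summable)+
    qed
  qed
  moreover have "invariant_measure G P \<longleftrightarrow>
          (\<forall>i. P (0, i) = (1 - \<rho>) * \<pi> i) \<and>
          (\<forall>n\<ge>1. \<forall>i. P (n, i) = (1 - \<rho>) * \<rho> ^ n * \<pi> i)" if lt: "lam < \<mu>" for P
  proof -
    have "(\<forall>i. P (0, i) = (1 - \<rho>) * \<pi> i) \<and> (\<forall>n\<ge>1. \<forall>i. P (n, i) = (1 - \<rho>) * \<rho> ^ n * \<pi> i)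
        \<longleftrightarrow> P = m" (is "?F \<longleftrightarrow> _")
    proof
      assume F: ?F
      have "P (n, i) = m (n, i)" for n i
        using F by (cases n) (auto simp: \<pi> m_def)
      then show "P = m" by auto
    qed (auto simp: \<pi> m_def)
    moreover have "P = m" if P: "invariant_measure G P"
    proof -
      \<comment> \<open>The constant is chosen such that the difference vanishes at \<open>(0, 0)\<close>.\<close>
      define c where "c = P (0, 0) / m (0, 0)"
      define h where "h z = P z + - c * m z" for z
      have "h z = 0" for z
      proof (rule signed_invariant_eq_0[where x = "(0, 0)"])
        show "h summable_on UNIV"
        proof -
          have "(h has_sum (1 + - c * 1)) UNIV"
            unfolding h_def using P m_inv[OF lt] unfolding invariant_measure_def
            by (intro has_sum_add has_sum_cmult_right) auto
          then show ?thesis by (rule has_sum_imp_summable)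
        qed
        show "- G y y \<le> lam + \<mu> + \<beta>" for y using exit_rate_le by (simp add: diagonal_eq)
        show "((\<lambda>z. h z * G z y) has_sum 0) UNIV" for y
        proof -
          have "((\<lambda>z. P z * G z y + - c * (m z * G z y)) has_sum (0 + - c * 0)) UNIV"
            using P m_inv[OF lt] unfolding invariant_measure_def
            by (intro has_sum_add has_sum_cmult_right) blast+
          then show ?thesis by (simp add: h_def algebra_simps)
        qed
        show "h (0, 0) = 0" using m_pos[OF lt, of "(0, 0)"] by (simp add: h_def c_def)
        show "(z, (0, 0)) \<in> {(x, y). 0 < G x y}\<^sup>*" for z by (rule reaches_empty)
      qed
      then have Pm: "P = (\<lambda>z. c * m z)" by (auto simp: h_def)
      have "(P has_sum c * 1) UNIV"
        unfolding Pm using m_inv[OF lt] by (intro has_sum_cmult_right) (simp add: invariant_measure_def)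
      moreover have "(P has_sum 1) UNIV" using P by (simp add: invariant_measure_def)
      ultimately have "c = 1" using has_sum_unique by fastforce
      then show ?thesis using Pm by simp
    qed
    ultimately show ?thesis using m_inv[OF lt] by blast
  qed
  ultimately show ?thesis using \<pi> by blast
qed

end
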